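(* For every $n\geq 2$, $FO(\mathbf{\Sigma}^0_1(\mathbb{R}^n))\equiv_m FO(\mathbb{N}_2)$.
   Context: $\mathbb{R}^n$ carries the Euclidean topology. $\mathbf{\Sigma}^0_1(X)$ denotes the lattice of all open subsets of $X$ (signature $\{\subseteq\}$), $FO(\mathbb{A})$ the set of first-order sentences true in $\mathbb{A}$, and $\equiv_m$ many-one equivalence (mutual many-one reducibility). $\mathbb{N}_2=(\omega\cup P(\omega);\omega,P(\omega),\in,+,\times)$ is the structure of second-order arithmetic. *)

theory Defs
  imports "HOL-Analysis.Analysis" "HOL-Library.Nat_Bijection"
begin

datatype recf = Zero | Succ | Proj nat | Comp recf "recf list" | Prim recf recf | Mu recf

inductive reval :: "recf \<Rightarrow> nat list \<Rightarrow> nat \<Rightarrow> bool" where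
  "reval Zero xs 0"
| "reval Succ (x # xs) (Suc x)"
| "i < length xs \<Longrightarrow> reval (Proj i) xs (xs ! i)"
| "list_all2 (\<lambda>g y. reval g xs y) gs ys \<Longrightarrow> reval f ys z \<Longrightarrow> reval (Comp f gs) xs z"
| "reval f xs z \<Longrightarrow> reval (Prim f g) (0 # xs) z"
| "reval (Prim f g) (n # xs) y \<Longrightarrow> reval g (y # n # xs) z \<Longrightarrow> reval (Prim f g) (Suc n # xs) z"
| "reval f (z # xs) 0 \<Longrightarrow> (\<forall>y<z. \<exists>w. reval f (y # xs) (Suc w)) \<Longrightarrow> reval (Mu f) xs z"

definition total_recursive :: "(nat \<Rightarrow> nat) \<Rightarrow> bool" where
  "total_recursive f \<longleftrightarrow> (\<exists>r. \<forall>x. reval r [x] (f x))"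

definition m_reducible :: "nat set \<Rightarrow> nat set \<Rightarrow> bool" where
  "m_reducible A B \<longleftrightarrow> (\<exists>f. total_recursive f \<and> (\<forall>x. x \<in> A \<longleftrightarrow> f x \<in> B))"

definition m_equiv :: "nat set \<Rightarrow> nat set \<Rightarrow> bool" where
  "m_equiv A B \<longleftrightarrow> m_reducible A B \<and> m_reducible B A"

datatype form = Rel nat "nat list" | Eq nat nat | Neg form | Conj form form | Ex nat form

fun fv :: "form \<Rightarrow> nat set" where
  "fv (Rel r vs) = set vs"
| "fv (Eq x y) = {x, y}"
| "fv (Neg p) = fv p"
| "fv (Conj p q) = fv p \<union> fv q"
| "fv (Ex x p) = fv p - {x}"

fun wf_form :: "(nat \<Rightarrow> nat option) \<Rightarrow> form \<Rightarrow> bool" where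
  "wf_form sig (Rel r vs) = (sig r = Some (length vs))"
| "wf_form sig (Eq x y) = True"
| "wf_form sig (Neg p) = wf_form sig p"
| "wf_form sig (Conj p q) = (wf_form sig p \<and> wf_form sig q)"
| "wf_form sig (Ex x p) = wf_form sig p"

fun sat :: "'a set \<Rightarrow> (nat \<Rightarrow> 'a list \<Rightarrow> bool) \<Rightarrow> (nat \<Rightarrow> 'a) \<Rightarrow> form \<Rightarrow> bool" where
  "sat D I s (Rel r vs) = I r (map s vs)"
| "sat D I s (Eq x y) = (s x = s y)"
| "sat D I s (Neg p) = (\<not> sat D I s p)"
| "sat D I s (Conj p q) = (sat D I s p \<and> sat D I s q)"
| "sat D I s (Ex x p) = (\<exists>a\<in>D. sat D I (s(x := a)) p)"

definition holds :: "'a set \<Rightarrow> (nat \<Rightarrow> 'a list \<Rightarrow> bool) \<Rightarrow> form \<Rightarrow> bool" where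
  "holds D I p \<longleftrightarrow> (\<forall>s. (\<forall>i. s i \<in> D) \<longrightarrow> sat D I s p)"

fun enc :: "form \<Rightarrow> nat" where
  "enc (Rel r vs) = prod_encode (0, prod_encode (r, list_encode vs))"
| "enc (Eq x y) = prod_encode (1, prod_encode (x, y))"
| "enc (Neg p) = prod_encode (2, enc p)"
| "enc (Conj p q) = prod_encode (3, prod_encode (enc p, enc q))"
| "enc (Ex x p) = prod_encode (4, prod_encode (x, enc p))"

definition FO :: "(nat \<Rightarrow> nat option) \<Rightarrow> 'a set \<Rightarrow> (nat \<Rightarrow> 'a list \<Rightarrow> bool) \<Rightarrow> nat set" where
  "FO sig D I = {enc p | p. wf_form sig p \<and> fv p = {} \<and> holds D I p}"

definition sig_sub :: "nat \<Rightarrow> nat option" where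
  "sig_sub r = (if r = 0 then Some 2 else None)"

definition open_lattice_dom :: "(real ^ 'n) set set" where
  "open_lattice_dom = {U. open U}"

fun subset_rel :: "nat \<Rightarrow> 'b set list \<Rightarrow> bool" where
  "subset_rel 0 [U, V] = (U \<subseteq> V)"
| "subset_rel _ _ = False"

definition sig_N2 :: "nat \<Rightarrow> nat option" where
  "sig_N2 r = (if r = 0 \<or> r = 1 then Some 1 else if r = 2 then Some 2
               else if r = 3 \<or> r = 4 then Some 3 else None)"

fun N2_rel :: "nat \<Rightarrow> (nat + nat set) list \<Rightarrow> bool" where
  "N2_rel 0 [x] = (\<exists>n. x = Inl n)"
| "N2_rel (Suc 0) [x] = (\<exists>S. x = Inr S)"
| "N2_rel (Suc (Suc 0)) [x, y] = (\<exists>n S. x = Inl n \<and> y = Inr S \<and> n \<in> S)"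
| "N2_rel (Suc (Suc (Suc 0))) [x, y, z] = (\<exists>a b. x = Inl a \<and> y = Inl b \<and> z = Inl (a + b))"
| "N2_rel (Suc (Suc (Suc (Suc 0)))) [x, y, z] = (\<exists>a b. x = Inl a \<and> y = Inl b \<and> z = Inl (a * b))"
| "N2_rel _ _ = False"

end

theory Submission
  imports Defs
begin

text \<open>
  Both reductions are interpretations with parameters, and an interpretation yields a recursive
  translation of codes of sentences.

  Second-order arithmetic is interpreted in the lattice of open sets as follows. For an open set
  \<open>G\<close>, the complemented elements of the interval \<open>[{}, G]\<close> are exactly the unions of connected
  components of \<open>G\<close>, so a single parameter \<open>G\<close> gives monadic second-order logic over its
  components. Two coordinate axes provide families of parallel slabs \<open>H\<close> and \<open>V\<close> whose
  intersection \<open>G\<close> is a grid of cells; a set of cells codes a binary relation between rows and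
  columns. With quantification over binary relations, a successor relation \<open>S\<close> satisfying the
  Dedekind axioms determines the natural numbers, and addition and multiplication are
  definable as least relations closed under their recursion equations.

  Conversely, \<open>x \<mapsto> exp x\<close> turns each coordinate of a point into a cut in the positive
  rationals. So points are coded by definable sets of numbers, open sets by sets of finite lists of
  rational intervals, and inclusion of open sets becomes definable.
\<close>

section \<open>Recursive functions\<close>

text \<open>The grid is not singled out inside the lattice, so its parameters are quantified
  existentially under the first-order condition \<open>goodF\<close>, and correctness must hold for
  every choice that satisfies it, not just for the slabs. This works because unions of components
  are arbitrary: induction over all unions of columns is full second-order induction, and the axioms
  have one model up to isomorphism. Numbers are the components of a further parameter
  \<open>D\<close>, in the concrete grid the diagonal cells: such a cell lies in one row and one
  column, so it can be either argument of a coded relation. Sets of numbers are unions of components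
  of \<open>V\<close>; no number is such a union, so the two sorts never overlap and equality of
  names is equality of open sets. Rows that cross columns need two independent coordinates, whence
  the bound on the dimension. In the other direction one open set has many codes, so equality
  becomes inclusion both ways. A reduction must also be right on numbers that code no sentence;
  therefore the translation preserves well-formedness and closedness in both directions.\<close>

named_theorems recfn_intros

text \<open>Fixing the arity lets the closure rules speak about plain terms in
  \<open>xs ! i\<close>, so that recursiveness of a concrete function is proved by applying
  introduction rules to its defining term.\<close>

definition recfn :: "nat \<Rightarrow> (nat list \<Rightarrow> nat) \<Rightarrow> bool" where
  "recfn k F \<longleftrightarrow> (\<exists>r. \<forall>xs. length xs = k \<longrightarrow> reval r xs (F xs))"

abbreviation recfn1 :: "(nat \<Rightarrow> nat) \<Rightarrow> bool" where
  "recfn1 h \<equiv> recfn 1 (\<lambda>xs. h (xs ! 0))"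

abbreviation recfn2 :: "(nat \<Rightarrow> nat \<Rightarrow> nat) \<Rightarrow> bool" where
  "recfn2 h \<equiv> recfn 2 (\<lambda>xs. h (xs ! 0) (xs ! 1))"

lemma recfn_cong:
  assumes "recfn k F" "\<And>xs. length xs = k \<Longrightarrow> F xs = G xs"
  shows "recfn k G"
  using assms unfolding recfn_def by metis

lemma recfn_total_recursive:
  assumes "recfn1 h"
  shows "total_recursive h"
proof -
  obtain r where r: "\<forall>xs. length xs = 1 \<longrightarrow> reval r xs (h (xs ! 0))"
    using assms unfolding recfn_def by blast
  have "reval r [x] (h x)" for x
    using r[rule_format, of "[x]"] by simp
  then show ?thesis
    unfolding total_recursive_def by blast
qed

lemma recfn_proj [recfn_intros]: "i < k \<Longrightarrow> recfn k (\<lambda>xs. xs ! i)"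
  unfolding recfn_def by (metis reval.intros(3))

lemma recfn_comp:
  assumes g: "recfn (length fs) g" and fs: "\<forall>f\<in>set fs. recfn k f"
  shows "recfn k (\<lambda>xs. g (map (\<lambda>f. f xs) fs))"
proof -
  obtain rg where rg: "\<forall>xs. length xs = length fs \<longrightarrow> reval rg xs (g xs)"
    using g unfolding recfn_def by blast
  have "\<exists>r. \<forall>f\<in>set fs. \<forall>xs. length xs = k \<longrightarrow> reval (r f) xs (f xs)"
    using fs unfolding recfn_def by (intro bchoice) blast
  then obtain r where r: "\<And>f xs. f \<in> set fs \<Longrightarrow> length xs = k \<Longrightarrow> reval (r f) xs (f xs)"
    by blast
  have "reval (Comp rg (map r fs)) xs (g (map (\<lambda>f. f xs) fs))" if "length xs = k" for xs
    using rg r[OF _ that]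
    by (intro reval.intros(4)[where ys = "map (\<lambda>f. f xs) fs"]) (auto simp: list_all2_conv_all_nth)
  then show ?thesis
    unfolding recfn_def by blast
qed

lemma recfn_app1:
  assumes "recfn1 h" "recfn k f"
  shows "recfn k (\<lambda>xs. h (f xs))"
  using recfn_comp[of "[f]" "\<lambda>xs. h (xs ! 0)" k] assms by simp

lemma recfn_app2:
  assumes "recfn2 h" "recfn k f" "recfn k g"
  shows "recfn k (\<lambda>xs. h (f xs) (g xs))"
  using recfn_comp[of "[f, g]" "\<lambda>xs. h (xs ! 0) (xs ! 1)" k] assms by (simp add: numeral_2_eq_2)

lemma recfn_Suc [recfn_intros]: "recfn k f \<Longrightarrow> recfn k (\<lambda>xs. Suc (f xs))"
proof (rule recfn_app1[of Suc])
  have "reval Succ xs (Suc (xs ! 0))" if "length xs = 1" for xs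
    using that reval.intros(2) by (cases xs) auto
  then show "recfn1 Suc"
    unfolding recfn_def by blast
qed

lemma recfn_const [recfn_intros]: "recfn k (\<lambda>_. c)"
proof (induction c)
  case 0
  show ?case
    unfolding recfn_def using reval.intros(1) by blast
qed (rule recfn_Suc)

lemma recfn_prim:
  assumes f: "recfn k f" and g: "recfn (Suc (Suc k)) g"
  shows "recfn (Suc k) (\<lambda>xs. rec_nat (f (tl xs)) (\<lambda>n y. g (y # n # tl xs)) (xs ! 0))"
proof -
  obtain rf rg where rf: "\<forall>xs. length xs = k \<longrightarrow> reval rf xs (f xs)"
    and rg: "\<forall>xs. length xs = Suc (Suc k) \<longrightarrow> reval rg xs (g xs)"
    using f g unfolding recfn_def by blast
  have "reval (Prim rf rg) (n # ys) (rec_nat (f ys) (\<lambda>n y. g (y # n # ys)) n)"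
    if "length ys = k" for n ys
    using that rf rg by (induction n) (auto intro!: reval.intros(5,6))
  then have "reval (Prim rf rg) xs (rec_nat (f (tl xs)) (\<lambda>n y. g (y # n # tl xs)) (xs ! 0))"
    if "length xs = Suc k" for xs
    using that by (cases xs) auto
  then show ?thesis
    unfolding recfn_def by blast
qed

lemma recfn1_rec:
  assumes "h 0 = c" "\<And>n. h (Suc n) = g (h n) n" "recfn2 g"
  shows "recfn1 h"
proof -
  have h: "h n = rec_nat c (\<lambda>n y. g y n) n" for n
    by (induction n) (simp_all add: assms)
  show ?thesis
    using recfn_prim[of 0 "\<lambda>_. c" "\<lambda>xs. g (xs ! 0) (xs ! 1)"] assms(3)
      recfn_const[of 0 c]
    by (simp add: h numeral_2_eq_2)
qed

lemma recfn2_rec: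
  assumes "\<And>y. h 0 y = f y" "\<And>n y. h (Suc n) y = g (h n y) n y" "recfn1 f"
    and g: "recfn 3 (\<lambda>xs. g (xs ! 0) (xs ! 1) (xs ! 2))"
  shows "recfn2 h"
proof -
  have h: "h n y = rec_nat (f y) (\<lambda>n z. g z n y) n" for n y
    by (induction n) (simp_all add: assms)
  have "recfn 2 (\<lambda>xs. rec_nat (f (tl xs ! 0)) (\<lambda>n y. g y n (tl xs ! 0)) (xs ! 0))"
    using recfn_prim[of 1 "\<lambda>xs. f (xs ! 0)" "\<lambda>xs. g (xs ! 0) (xs ! 1) (xs ! 2)"] assms(3) g
    by (simp add: numeral_2_eq_2 numeral_3_eq_3)
  then show ?thesis
    by (rule recfn_cong) (simp add: h nth_tl)
qed

lemma recfn_add [recfn_intros]: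
  assumes "recfn k f" "recfn k g"
  shows "recfn k (\<lambda>xs. f xs + g xs)"
proof -
  have "recfn2 (+)"
    by (rule recfn2_rec[of _ "\<lambda>y. y" "\<lambda>z _ _. Suc z"]) (auto intro!: recfn_intros)
  from recfn_app2[OF this assms] show ?thesis .
qed

lemma recfn_mult [recfn_intros]:
  assumes "recfn k f" "recfn k g"
  shows "recfn k (\<lambda>xs. f xs * g xs)"
proof -
  have "recfn2 (*)"
    by (rule recfn2_rec[of _ "\<lambda>y. 0" "\<lambda>z _ y. y + z"]) (auto intro!: recfn_intros)
  from recfn_app2[OF this assms] show ?thesis .
qed

lemma recfn_diff [recfn_intros]:
  assumes "recfn k f" "recfn k g"
  shows "recfn k (\<lambda>xs. f xs - g xs)"
proof -
  have "recfn1 (\<lambda>n. n - 1)"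
    by (rule recfn1_rec[of _ 0 "\<lambda>_ n. n"]) (auto intro!: recfn_intros)
  note pred = recfn_app1[OF this]
  \<comment> \<open>The recursion runs on the subtrahend, so the arguments are swapped here;
    \<open>assms(2,1)\<close> swaps them back.\<close>
  have "recfn2 (\<lambda>n y. y - n)"
    by (rule recfn2_rec[of _ "\<lambda>y. y" "\<lambda>z _ y. z - 1"]) (auto intro!: pred[unfolded One_nat_def] recfn_intros)
  from recfn_app2[OF this assms(2,1)] show ?thesis .
qed

lemma recfn_if [recfn_intros]:
  assumes "recfn k f" "recfn k g" "recfn k a" "recfn k b"
  shows "recfn k (\<lambda>xs. if f xs = g xs then a xs else b xs)"
proof (rule recfn_cong)
  \<comment> \<open>The distance of the two values. Truncated subtraction makes
    \<open>1 - ?d xs\<close> the characteristic function of equality.\<close>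
  let ?d = "\<lambda>xs. (f xs - g xs) + (g xs - f xs)"
  show "recfn k (\<lambda>xs. (1 - ?d xs) * a xs + (1 - (1 - ?d xs)) * b xs)"
    by (intro recfn_add recfn_mult recfn_diff recfn_const assms)
qed auto

lemma recfn_triangle [recfn_intros]:
  assumes "recfn k f"
  shows "recfn k (\<lambda>xs. triangle (f xs))"
proof -
  have "recfn1 triangle"
    by (rule recfn1_rec[of _ 0 "\<lambda>y n. y + Suc n"]) (auto intro!: recfn_intros)
  from recfn_app1[OF this assms] show ?thesis .
qed

lemma recfn_prod_encode [recfn_intros]:
  assumes "recfn k f" "recfn k g"
  shows "recfn k (\<lambda>xs. prod_encode (f xs, g xs))"
  unfolding prod_encode_def prod.case by (intro recfn_intros assms)

text \<open>The largest \<open>k\<close> with \<open>triangle k \<le> n\<close>, the root needed to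
  undo Cantor pairing. The comparison is written as a vanishing truncated difference because
  \<open>recfn_if\<close> tests equalities only.\<close>

primrec tri_root :: "nat \<Rightarrow> nat" where
  "tri_root 0 = 0"
| "tri_root (Suc n) =
    (if triangle (Suc (tri_root n)) - Suc n = 0 then Suc (tri_root n) else tri_root n)"

lemma tri_root_bounds: "triangle (tri_root n) \<le> n \<and> n < triangle (Suc (tri_root n))"
  by (induction n) auto

text \<open>A pair \<open>(m, n)\<close> has the code \<open>triangle (m + n) + m\<close>: the root
  recovers the sum and the remainder is the first component.\<close>

lemma prod_decode_tri_root:
  "prod_decode n = (n - triangle (tri_root n), tri_root n - (n - triangle (tri_root n)))"
proof -
  have "n = prod_encode (n - triangle (tri_root n), tri_root n - (n - triangle (tri_root n)))"
    using tri_root_bounds[of n] by (simp add: prod_encode_def)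
  then show ?thesis
    by (metis prod_encode_inverse)
qed

lemma recfn_tri_root [recfn_intros]:
  assumes "recfn k f"
  shows "recfn k (\<lambda>xs. tri_root (f xs))"
proof -
  have "recfn1 tri_root"
    by (rule recfn1_rec[of _ 0 "\<lambda>y n. if triangle (Suc y) - Suc n = 0 then Suc y else y"])
      (simp, simp, intro recfn_intros, simp_all)
  from recfn_app1[OF this assms] show ?thesis .
qed

lemma recfn_fst_prod_decode [recfn_intros]: "recfn k f \<Longrightarrow> recfn k (\<lambda>xs. fst (prod_decode (f xs)))"
  by (auto simp: prod_decode_tri_root intro!: recfn_intros)

lemma recfn_snd_prod_decode [recfn_intros]: "recfn k f \<Longrightarrow> recfn k (\<lambda>xs. snd (prod_decode (f xs)))"
  by (auto simp: prod_decode_tri_root intro!: recfn_intros)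

text \<open>Head and tail on codes of lists. The code of a nonempty list is the successor of a pair,
  hence the \<open>c - 1\<close>.\<close>

definition lhd :: "nat \<Rightarrow> nat" where
  "lhd c = fst (prod_decode (c - 1))"

definition ltl :: "nat \<Rightarrow> nat" where
  "ltl c = snd (prod_decode (c - 1))"

lemma lhd_list_encode [simp]: "lhd (list_encode (x # xs)) = x"
  by (simp add: lhd_def)

lemma ltl_list_encode [simp]: "ltl (list_encode (x # xs)) = list_encode xs"
  by (simp add: ltl_def)

lemma lhd_funpow_ltl: "i < length xs \<Longrightarrow> lhd ((ltl ^^ i) (list_encode xs)) = xs ! i"
proof (induction i arbitrary: xs)
  case (0 xs)
  then show ?case by (cases xs) (auto simp del: list_encode.simps)
next
  case (Suc i xs)
  then show ?case
    by (cases xs) (auto simp del: list_encode.simps simp: funpow_swap1 funpow_Suc_right simp del: funpow.simps)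
qed

lemma recfn_lhd [recfn_intros]: "recfn k f \<Longrightarrow> recfn k (\<lambda>xs. lhd (f xs))"
  unfolding lhd_def by (intro recfn_intros)

lemma recfn_ltl [recfn_intros]: "recfn k f \<Longrightarrow> recfn k (\<lambda>xs. ltl (f xs))"
  unfolding ltl_def by (intro recfn_intros)

lemma recfn_funpow_ltl [recfn_intros]:
  assumes "recfn k f" "recfn k g"
  shows "recfn k (\<lambda>xs. (ltl ^^ f xs) (g xs))"
proof -
  have "recfn2 (\<lambda>n. ltl ^^ n)"
    by (rule recfn2_rec[of _ "\<lambda>y. y" "\<lambda>z _ y. ltl z"]) (auto intro!: recfn_intros)
  from recfn_app2[OF this assms] show ?thesis .
qed

text \<open>The newest value stands first, so one pairing extends the history, and the value at
  \<open>m\<close> sits at depth \<open>n - Suc m\<close>.\<close>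

definition history :: "(nat \<Rightarrow> nat) \<Rightarrow> nat \<Rightarrow> nat" where
  "history G n = list_encode (map G (rev [0..<n]))"

lemma history_lookup:
  assumes "m < n"
  shows "lhd ((ltl ^^ (n - Suc m)) (history G n)) = G m"
proof -
  have "rev [0..<n] ! (n - Suc m) = m"
    using assms by (subst rev_nth) auto
  then show ?thesis
    using assms by (simp add: history_def lhd_funpow_ltl)
qed

text \<open>The history itself is primitive recursive. This is what allows recursion on codes of
  formulas, where the recursive calls go to smaller numbers and not to the predecessor.\<close>

lemma recfn1_course_of_values:
  assumes "recfn2 step" "\<And>n. G n = step n (history G n)"
  shows "recfn1 G"
proof -
  have "recfn1 (history G)"
  proof (rule recfn1_rec)
    show "history G 0 = 0"
      by (simp add: history_def)
    show "history G (Suc n) = Suc (prod_encode (step n (history G n), history G n))" for n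
      using assms(2)[of n] by (simp add: history_def)
    show "recfn2 (\<lambda>y n. Suc (prod_encode (step n y, y)))"
      by (intro recfn_Suc recfn_prod_encode recfn_app2[OF assms(1)] recfn_proj) auto
  qed
  then have "recfn1 (\<lambda>n. step n (history G n))"
    by (intro recfn_app2[OF assms(1)] recfn_proj) auto
  then show ?thesis
    using assms(2) by simp
qed

section \<open>Formulas and interpretations\<close>

fun bv :: "form \<Rightarrow> nat set" where
  "bv (Rel r vs) = {}"
| "bv (Eq x y) = {}"
| "bv (Neg p) = bv p"
| "bv (Conj p q) = bv p \<union> bv q"
| "bv (Ex x p) = insert x (bv p)"

fun ren :: "(nat \<Rightarrow> nat) \<Rightarrow> form \<Rightarrow> form" where
  "ren \<rho> (Rel r vs) = Rel r (map \<rho> vs)"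
| "ren \<rho> (Eq x y) = Eq (\<rho> x) (\<rho> y)"
| "ren \<rho> (Neg p) = Neg (ren \<rho> p)"
| "ren \<rho> (Conj p q) = Conj (ren \<rho> p) (ren \<rho> q)"
| "ren \<rho> (Ex x p) = Ex (\<rho> x) (ren \<rho> p)"

lemma sat_cong: "(\<And>v. v \<in> fv p \<Longrightarrow> s v = t v) \<Longrightarrow> sat D I s p = sat D I t p"
proof (induction p arbitrary: s t)
  case (Rel r vs)
  then have "map s vs = map t vs"
    by simp
  then show ?case
    by (simp only: sat.simps)
next
  case (Neg p)
  then show ?case by (metis fv.simps(3) sat.simps(3))
next
  case (Conj p q)
  have "sat D I s p = sat D I t p"
    by (rule Conj.IH(1)) (simp add: Conj.prems)
  moreover have "sat D I s q = sat D I t q"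
    by (rule Conj.IH(2)) (simp add: Conj.prems)
  ultimately show ?case by simp
next
  case (Ex x p)
  have "sat D I (s(x := a)) p = sat D I (t(x := a)) p" for a
    using Ex.prems by (intro Ex.IH) auto
  then show ?case by simp
qed auto

text \<open>\<open>ren\<close> renames bound variables too and avoids no capture. The hypothesis
  ensures that an update at \<open>\<rho> x\<close> changes the pulled-back assignment at
  \<open>x\<close> only.\<close>

lemma sat_ren:
  "(\<And>x v. x \<in> bv p \<Longrightarrow> \<rho> v = \<rho> x \<Longrightarrow> v = x) \<Longrightarrow> sat D I s (ren \<rho> p) = sat D I (s \<circ> \<rho>) p"
proof (induction p arbitrary: s)
  case (Conj p q)
  have "sat D I s (ren \<rho> p) = sat D I (s \<circ> \<rho>) p"
    by (rule Conj.IH(1), use Conj.prems in auto)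
  moreover have "sat D I s (ren \<rho> q) = sat D I (s \<circ> \<rho>) q"
    by (rule Conj.IH(2), use Conj.prems in auto)
  ultimately show ?case by (simp only: ren.simps sat.simps)
next
  case (Ex x p)
  have "(s(\<rho> x := a)) \<circ> \<rho> = (s \<circ> \<rho>)(x := a)" for a
    using Ex.prems[of x] by (auto simp: fun_eq_iff)
  moreover have "sat D I (s(\<rho> x := a)) (ren \<rho> p) = sat D I (s(\<rho> x := a) \<circ> \<rho>) p" for a
    by (rule Ex.IH, use Ex.prems in auto)
  ultimately show ?case
    by (simp only: ren.simps sat.simps)
qed auto

lemma fv_ren:
  "(\<And>x v. x \<in> bv p \<Longrightarrow> \<rho> v = \<rho> x \<Longrightarrow> v = x) \<Longrightarrow> fv (ren \<rho> p) = \<rho> ` fv p"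
proof (induction p)
  case (Ex x p)
  then have "fv (ren \<rho> p) = \<rho> ` fv p"
    by auto
  moreover have "\<rho> ` fv p - {\<rho> x} = \<rho> ` (fv p - {x})"
    using Ex.prems[of x] by auto
  ultimately show ?case by simp
qed auto

lemma wf_ren: "wf_form sig (ren \<rho> p) = wf_form sig p"
  by (induction p) auto

definition FAll :: "nat \<Rightarrow> form \<Rightarrow> form" where
  "FAll x p = Neg (Ex x (Neg p))"

definition FImp :: "form \<Rightarrow> form \<Rightarrow> form" where
  "FImp p q = Neg (Conj p (Neg q))"

definition FOr :: "form \<Rightarrow> form \<Rightarrow> form" where
  "FOr p q = Neg (Conj (Neg p) (Neg q))"

lemma connectives [simp]:
  "sat D I s (FAll x p) \<longleftrightarrow> (\<forall>a\<in>D. sat D I (s(x := a)) p)"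
  "sat D I s (FImp p q) \<longleftrightarrow> (sat D I s p \<longrightarrow> sat D I s q)"
  "sat D I s (FOr p q) \<longleftrightarrow> sat D I s p \<or> sat D I s q"
  "fv (FAll x p) = fv p - {x}" "fv (FImp p q) = fv p \<union> fv q" "fv (FOr p q) = fv p \<union> fv q"
  "bv (FAll x p) = insert x (bv p)" "bv (FImp p q) = bv p \<union> bv q" "bv (FOr p q) = bv p \<union> bv q"
  "wf_form sig (FAll x p) = wf_form sig p" "wf_form sig (FImp p q) = (wf_form sig p \<and> wf_form sig q)"
  "wf_form sig (FOr p q) = (wf_form sig p \<and> wf_form sig q)"
  by (auto simp: FAll_def FImp_def FOr_def)

abbreviation exs :: "nat list \<Rightarrow> form \<Rightarrow> form" where
  "exs xs p \<equiv> foldr Ex xs p"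

lemma fv_exs: "fv (exs xs p) = fv p - set xs"
  by (induction xs) auto

lemma wf_exs: "wf_form sig (exs xs p) = wf_form sig p"
  by (induction xs) auto

lemma sat_exs:
  "sat D I s (exs xs p) \<longleftrightarrow>
    (\<exists>e. (\<forall>v. v \<notin> set xs \<longrightarrow> e v = s v) \<and> (\<forall>v\<in>set xs. e v \<in> D) \<and> sat D I e p)"
proof (induction xs arbitrary: s)
  case Nil
  have "e = s" if "\<forall>v. e v = s v" for e
    using that by auto
  then show ?case by auto
next
  case (Cons x xs)
  have "sat D I s (exs (x # xs) p) \<longleftrightarrow> (\<exists>a\<in>D. \<exists>e. (\<forall>v. v \<notin> set xs \<longrightarrow> e v = (s(x := a)) v) \<and>
      (\<forall>v\<in>set xs. e v \<in> D) \<and> sat D I e p)"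
    by (simp add: Cons.IH)
  also have "\<dots> \<longleftrightarrow> (\<exists>e. (\<forall>v. v \<notin> set (x # xs) \<longrightarrow> e v = s v) \<and>
      (\<forall>v\<in>set (x # xs). e v \<in> D) \<and> sat D I e p)" (is "?L \<longleftrightarrow> ?R")
  proof
    assume ?L
    then obtain a e where "a \<in> D" "\<forall>v. v \<notin> set xs \<longrightarrow> e v = (s(x := a)) v"
      "\<forall>v\<in>set xs. e v \<in> D" "sat D I e p"
      by blast
    \<comment> \<open>If \<open>x\<close> occurs again in \<open>xs\<close>, the inner quantifier
      has overwritten \<open>a\<close>; hence the case split.\<close>
    moreover from this have "e x \<in> D"
      by (cases "x \<in> set xs") auto
    ultimately show ?R
      by (intro exI[of _ e]) auto
  next
    assume ?R
    then obtain e where "\<forall>v. v \<notin> set (x # xs) \<longrightarrow> e v = s v"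
      "\<forall>v\<in>set (x # xs). e v \<in> D" "sat D I e p"
      by blast
    then show ?L
      by (intro bexI[of _ "e x"] exI[of _ e]) auto
  qed
  finally show ?case .
qed

section \<open>Decoding formulas from numbers\<close>

function dec :: "nat \<Rightarrow> form" where
  "dec n = (let t = fst (prod_decode n); m = snd (prod_decode n);
                a = fst (prod_decode m); b = snd (prod_decode m) in
     if t = 0 then Rel a (list_decode b)
     else if t = 1 then Eq a b
     else if t = 2 then Neg (dec m)
     else if t = 3 then Conj (dec a) (dec b)
     else if t = 4 then Ex a (dec b)
     else Rel 0 [])"
  by auto

text \<open>The code is \<open>triangle (t + m) + t\<close> and triangles dominate their index, so a
  positive tag puts the code strictly above its payload. Tag \<open>0\<close> belongs to
  \<open>Rel\<close>, which has no subformula, so termination never asks for that case.\<close>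

lemma prod_decode_less:
  assumes "fst (prod_decode n) \<noteq> 0"
  shows "snd (prod_decode n) < n"
proof -
  obtain t m where tm: "prod_decode n = (t, m)"
    by fastforce
  then have n: "n = prod_encode (t, m)"
    by (metis prod_decode_inverse)
  have "triangle k \<ge> k" for k
    by (induction k) auto
  from this[of "t + m"] show ?thesis
    using assms tm n by (simp add: prod_encode_def)
qed

lemma snd_prod_decode_le: "snd (prod_decode n) \<le> n"
  using le_prod_encode_2[of "snd (prod_decode n)" "fst (prod_decode n)"] by simp

lemma fst_prod_decode_le: "fst (prod_decode n) \<le> n"
  using le_prod_encode_1[of "fst (prod_decode n)" "snd (prod_decode n)"] by simp

termination dec
  by (relation "Wellfounded.measure (\<lambda>n. n)")
    (auto intro: prod_decode_less le_less_trans[OF snd_prod_decode_le prod_decode_less]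
      le_less_trans[OF fst_prod_decode_le prod_decode_less])

declare dec.simps [simp del]

lemma dec_enc: "dec (enc p) = p"
  by (induction p) (subst dec.simps, simp)+

text \<open>Numbers that are not codes are decoded to a formula with the ill-formed subformula
  \<open>Rel 0 []\<close>.\<close>

lemma enc_dec:
  assumes "sig 0 \<noteq> Some 0"
  shows "wf_form sig (dec n) \<Longrightarrow> enc (dec n) = n"
proof (induction n rule: less_induct)
  case (less n)
  obtain t m where tm: "prod_decode n = (t, m)"
    by fastforce
  obtain a b where ab: "prod_decode m = (a, b)"
    by fastforce
  have n: "n = prod_encode (t, m)" and m: "m = prod_encode (a, b)"
    using tm ab by (metis prod_decode_inverse)+
  have lt: "m < n" if "t \<noteq> 0"
    using prod_decode_less[of n] tm that by simp
  have le: "a \<le> m" "b \<le> m"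
    unfolding m by (rule le_prod_encode_1, rule le_prod_encode_2)
  have wf: "wf_form sig (if t = 0 then Rel a (list_decode b) else if t = 1 then Eq a b
     else if t = 2 then Neg (dec m) else if t = 3 then Conj (dec a) (dec b)
     else if t = 4 then Ex a (dec b) else Rel 0 [])"
    using less.prems by (subst (asm) dec.simps) (simp add: tm ab)
  have *: "dec n = (if t = 0 then Rel a (list_decode b) else if t = 1 then Eq a b
     else if t = 2 then Neg (dec m) else if t = 3 then Conj (dec a) (dec b)
     else if t = 4 then Ex a (dec b) else Rel 0 [])"
    by (subst dec.simps) (simp add: tm ab)
  consider "t = 0 \<or> t = 1" | "t = 2" | "t = 3" | "t = 4"
    using wf assms by (auto split: if_splits)
  then show ?case
  proof cases
    case 1
    then show ?thesis unfolding * by (auto simp: n m)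
  next
    case 2
    then show ?thesis using less.IH[OF lt] wf * n by simp
  next
    case 3
    have "a < n" "b < n"
      using lt le 3 by auto
    then show ?thesis using less.IH[of a] less.IH[of b] wf * n m 3 by simp
  next
    case 4
    have "b < n"
      using lt le 4 by auto
    then show ?thesis using less.IH[of b] wf * n m 4 by simp
  qed
qed

section \<open>Plugging variables into templates\<close>

definition inst :: "nat \<Rightarrow> nat list \<Rightarrow> nat \<Rightarrow> nat" where
  "inst K vs v = (if v < length vs then vs ! v + K else v)"

definition update :: "(nat \<Rightarrow> 'b) \<Rightarrow> 'b list \<Rightarrow> nat \<Rightarrow> 'b" where
  "update e bs v = (if v < length bs then bs ! v else e v)"

text \<open>A template has the placeholder variables \<open>0, \<dots>, a - 1\<close> and the parameters \<open>P\<close>. The variable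
  \<open>x\<close> of an interpreted formula becomes \<open>x + K\<close>, so that instantiation captures no variable.\<close>

definition template :: "(nat \<Rightarrow> nat option) \<Rightarrow> nat set \<Rightarrow> nat \<Rightarrow> nat \<Rightarrow> form \<Rightarrow> bool" where
  "template sig P K a \<theta> \<longleftrightarrow> wf_form sig \<theta> \<and> {..<a} \<subseteq> fv \<theta> \<and> fv \<theta> \<subseteq> {..<a} \<union> P \<and>
     bv \<theta> \<subseteq> {a..<K} \<and> P \<subseteq> {a..<K}"

text \<open>Placeholders are sent to \<open>K\<close> or above, whereas bound variables lie in
  \<open>{a..<K}\<close> and stay fixed. This discharges the hypothesis of \<open>sat_ren\<close>
  and \<open>fv_ren\<close>.\<close>

lemma inst_bound:
  assumes "template sig P K (length vs) \<theta>" "x \<in> bv \<theta>" "inst K vs v = inst K vs x"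
  shows "v = x"
proof -
  have "x \<ge> length vs" "x < K"
    using assms(1,2) by (auto simp: template_def)
  then show ?thesis
    using assms(3) by (auto simp: inst_def split: if_splits)
qed

lemma fv_inst:
  assumes "template sig P K (length vs) \<theta>"
  shows "fv (ren (inst K vs) \<theta>) - P = (\<lambda>x. x + K) ` set vs"
proof -
  have "fv (ren (inst K vs) \<theta>) = inst K vs ` fv \<theta>"
    using inst_bound[OF assms] by (rule fv_ren)
  moreover have "inst K vs ` {..<length vs} = (\<lambda>x. x + K) ` set vs"
    by (auto simp: inst_def set_conv_nth image_iff)
  moreover have "fv \<theta> = {..<length vs} \<union> (fv \<theta> \<inter> P)"
    using assms by (auto simp: template_def)
  moreover have "inst K vs ` (fv \<theta> \<inter> P) \<subseteq> P"
    using assms by (auto simp: template_def inst_def)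
  moreover have "((\<lambda>x. x + K) ` set vs) \<inter> P = {}"
    using assms by (auto simp: template_def)
  ultimately show ?thesis
    by (metis (no_types, lifting) Diff_eq_empty_iff Diff_triv Un_Diff image_Un sup_bot_right)
qed

lemma sat_inst:
  assumes "template sig P K (length vs) \<theta>" "\<And>v. v \<in> P \<Longrightarrow> t v = e v"
  shows "sat D I t (ren (inst K vs) \<theta>) = sat D I (update e (map (\<lambda>x. t (x + K)) vs)) \<theta>"
proof -
  have "sat D I t (ren (inst K vs) \<theta>) = sat D I (t \<circ> inst K vs) \<theta>"
    using inst_bound[OF assms(1)] by (rule sat_ren)
  also have "\<dots> = sat D I (update e (map (\<lambda>x. t (x + K)) vs)) \<theta>"
    using assms by (intro sat_cong) (auto simp: template_def update_def inst_def)
  finally show ?thesis .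
qed

lemma recfn_list_encode_map [recfn_intros]:
  "\<forall>f\<in>set fs. recfn k f \<Longrightarrow> recfn k (\<lambda>xs. list_encode (map (\<lambda>f. f xs) fs))"
  by (induction fs) (auto intro!: recfn_intros)

lemma recfn_inst:
  assumes "\<forall>f\<in>set fs. recfn k f"
  shows "recfn k (\<lambda>xs. inst K (map (\<lambda>f. f xs) fs) v)"
proof (cases "v < length fs")
  case True
  then have "recfn k (\<lambda>xs. (fs ! v) xs + K)"
    using assms by (auto intro!: recfn_intros)
  then show ?thesis
    using True by (simp add: inst_def)
qed (auto simp: inst_def intro!: recfn_intros)

text \<open>The template is fixed and only the inserted variables depend on the input, so induction
  on the template suffices and no recursion on codes occurs.\<close>

lemma recfn_enc_ren_inst:
  assumes "\<forall>f\<in>set fs. recfn k f"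
  shows "recfn k (\<lambda>xs. enc (ren (inst K (map (\<lambda>f. f xs) fs)) \<theta>))"
proof (induction \<theta>)
  case (Rel r vs)
  have "recfn k (\<lambda>xs. list_encode (map (\<lambda>f. f xs)
      (map (\<lambda>v xs. inst K (map (\<lambda>f. f xs) fs) v) vs)))"
    by (intro recfn_list_encode_map) (auto intro!: recfn_inst[OF assms])
  then show ?case
    by (auto intro!: recfn_intros simp: comp_def)
qed (auto intro!: recfn_intros recfn_inst[OF assms])

primrec has_length :: "nat \<Rightarrow> nat \<Rightarrow> nat" where
  "has_length 0 l = (if l = 0 then 1 else 0)"
| "has_length (Suc a) l = (if l = 0 then 0 else has_length a (ltl l))"

lemma has_length: "has_length a (list_encode xs) = (if length xs = a then 1 else 0)"
proof (induction a arbitrary: xs)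
  case (0 xs)
  then show ?case by (cases xs) auto
next
  case (Suc a xs)
  then show ?case by (cases xs) (auto simp: ltl_def)
qed

lemma recfn_has_length [recfn_intros]: "recfn k f \<Longrightarrow> recfn k (\<lambda>xs. has_length a (f xs))"
proof (induction a arbitrary: f)
  case (Suc a f)
  have "recfn k (\<lambda>xs. has_length a (ltl (f xs)))"
    using Suc.prems by (intro Suc.IH recfn_intros)
  then show ?case
    using Suc.prems by (auto intro!: recfn_intros)
qed (auto intro!: recfn_intros)

section \<open>Interpretations with parameters\<close>

lemma prod_encode_0: "prod_encode (0, 0) = 0"
  by (simp add: prod_encode_def)

text \<open>The syntactic half of an interpretation: \<open>dl\<close> defines the domain,
  \<open>eq\<close> the equality, \<open>psi r\<close> the relation \<open>r\<close> of arity
  \<open>ars ! r\<close>, and \<open>gm\<close> the admissible values of the parameters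
  \<open>ps\<close>. Symbol \<open>0\<close> is not nullary on either side, which makes
  \<open>Rel 0 []\<close> ill-formed on both and thus usable as a marker for bad input.\<close>

locale interpretation_scheme =
  fixes ars :: "nat list" and sigB :: "nat \<Rightarrow> nat option"
    and psi :: "nat \<Rightarrow> form" and dl eq gm :: form and ps :: "nat list" and K :: nat
  assumes ars: "ars \<noteq> []" "ars ! 0 \<noteq> 0"
    and psi: "\<And>r. r < length ars \<Longrightarrow> template sigB (set ps) K (ars ! r) (psi r)"
    and dl: "template sigB (set ps) K 1 dl"
    and eq: "template sigB (set ps) K 2 eq"
    and gm: "wf_form sigB gm" "fv gm \<subseteq> set ps"
    and sigB: "sigB 0 \<noteq> Some 0"
begin

definition sigA :: "nat \<Rightarrow> nat option" where
  "sigA r = (if r < length ars then Some (ars ! r) else None)"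

fun tr :: "form \<Rightarrow> form" where
  "tr (Rel r vs) = (if r < length ars \<and> length vs = ars ! r then ren (inst K vs) (psi r) else Rel 0 [])"
| "tr (Eq x y) = ren (inst K [x, y]) eq"
| "tr (Neg p) = Neg (tr p)"
| "tr (Conj p q) = Conj (tr p) (tr q)"
| "tr (Ex x p) = Ex (x + K) (Conj (ren (inst K [x]) dl) (tr p))"

lemma template_inst_wf:
  "template sig P K' a \<theta> \<Longrightarrow> wf_form sig (ren \<rho> \<theta>)"
  by (simp add: wf_ren template_def)

text \<open>Both directions count: an ill-formed input has to leave the target theory as
  well.\<close>

lemma wf_tr: "wf_form sigB (tr p) \<longleftrightarrow> wf_form sigA p"
  using template_inst_wf[OF psi] template_inst_wf[OF eq] template_inst_wf[OF dl] sigB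
  by (induction p) (auto simp: sigA_def)

text \<open>An equation and not an inclusion, since inputs with free variables must be rejected too.
  This is why \<open>template\<close> asks every placeholder to occur.\<close>

lemma fv_tr: "wf_form sigA p \<Longrightarrow> fv (tr p) - set ps = (\<lambda>x. x + K) ` fv p"
proof (induction p)
  case (Rel r vs)
  then show ?case
    using fv_inst[of sigB "set ps" K vs "psi r"] psi by (auto simp: sigA_def split: if_splits)
next
  case (Eq x y)
  show ?case
    using fv_inst[of sigB "set ps" K "[x, y]" eq] eq by (simp add: numeral_2_eq_2)
next
  case (Ex x p)
  have "fv (ren (inst K [x]) dl) - set ps = {x + K}"
    using fv_inst[of sigB "set ps" K "[x]" dl] dl by simp
  then have "fv (tr (Ex x p)) - set ps = (fv (tr p) - set ps) - {x + K}"
    by auto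
  also have "\<dots> = (\<lambda>x. x + K) ` (fv p - {x})"
    using Ex by auto
  finally show ?case by simp
qed auto

definition reduct :: "form \<Rightarrow> form" where
  "reduct p = exs ps (Conj gm (tr p))"

lemma wf_reduct: "wf_form sigB (reduct p) \<longleftrightarrow> wf_form sigA p"
  using gm by (simp add: reduct_def wf_exs wf_tr)

lemma fv_reduct: "wf_form sigA p \<Longrightarrow> fv (reduct p) = (\<lambda>x. x + K) ` fv p"
  using gm fv_tr[of p] by (auto simp: reduct_def fv_exs)

text \<open>The number-level version of \<open>tr\<close> on atoms, by cases over the finitely many
  relation symbols. The value \<open>0\<close> is the code of \<open>Rel 0 []\<close>.\<close>

primrec tr_atom :: "nat \<Rightarrow> nat \<Rightarrow> nat \<Rightarrow> nat" where
  "tr_atom 0 r l = 0"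
| "tr_atom (Suc j) r l = (if r = j then if has_length (ars ! j) l = 0 then 0
     else enc (ren (inst K (map (\<lambda>i. lhd ((ltl ^^ i) l)) [0..<ars ! j])) (psi j))
     else tr_atom j r l)"

lemma tr_atom: "tr_atom n r (list_encode vs) =
  (if r < n \<and> length vs = ars ! r then enc (ren (inst K vs) (psi r)) else 0)"
proof -
  have "map (\<lambda>i. lhd ((ltl ^^ i) (list_encode vs))) [0..<length vs] = vs"
    by (intro nth_equalityI) (auto simp: lhd_funpow_ltl)
  then show ?thesis
    by (induction n) (auto simp: has_length less_Suc_eq)
qed

lemma recfn_tr_atom [recfn_intros]:
  assumes "recfn k f" "recfn k g"
  shows "recfn k (\<lambda>xs. tr_atom n (f xs) (g xs))"
proof (induction n)
  case (Suc n)
  have "recfn k (\<lambda>xs. enc (ren (inst K (map (\<lambda>h. h xs)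
      (map (\<lambda>i xs. lhd ((ltl ^^ i) (g xs))) [0..<ars ! n]))) (psi n)))"
    by (intro recfn_enc_ren_inst) (auto intro!: recfn_intros assms)
  then have *: "recfn k (\<lambda>xs. enc (ren (inst K
      (map (\<lambda>i. lhd ((ltl ^^ i) (g xs))) [0..<ars ! n])) (psi n)))"
    by (simp add: comp_def)
  show ?case
    unfolding tr_atom.simps by (intro recfn_if Suc * recfn_const recfn_has_length assms)
qed (simp add: recfn_const)

lemma recfn_tr_dec: "recfn1 (\<lambda>n. enc (tr (dec n)))"
proof (rule recfn1_course_of_values)
  let ?G = "\<lambda>n. enc (tr (dec n))"
  let ?l = "\<lambda>n h m. lhd ((ltl ^^ (n - Suc m)) h)"
  let ?t = "\<lambda>n. fst (prod_decode n)" and ?m = "\<lambda>n. snd (prod_decode n)"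
  let ?a = "\<lambda>n. fst (prod_decode (snd (prod_decode n)))"
  let ?b = "\<lambda>n. snd (prod_decode (snd (prod_decode n)))"
  \<comment> \<open>\<open>tr\<close> performed on codes: \<open>?l n h m\<close> reads the
    translation of a subformula with code \<open>m < n\<close> from the history \<open>h\<close>,
    and unknown tags give \<open>0\<close>, the code of \<open>Rel 0 []\<close>.\<close>
  define step where "step n h =
    (if ?t n = 0 then tr_atom (length ars) (?a n) (?b n)
     else if ?t n = 1 then enc (ren (inst K [?a n, ?b n]) eq)
     else if ?t n = 2 then prod_encode (2, ?l n h (?m n))
     else if ?t n = 3 then prod_encode (3, prod_encode (?l n h (?a n), ?l n h (?b n)))
     else if ?t n = 4 then prod_encode (4, prod_encode (?a n + K, prod_encode (3, prod_encode
        (enc (ren (inst K [?a n]) dl), ?l n h (?b n)))))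
     else 0)" for n h
  have 1: "recfn 2 (\<lambda>xs. enc (ren (inst K [?a (xs ! 0), ?b (xs ! 0)]) eq))"
    by (rule recfn_enc_ren_inst[of "[\<lambda>xs. ?a (xs ! 0), \<lambda>xs. ?b (xs ! 0)]" 2 K eq, simplified])
      (intro conjI recfn_intros, simp_all)
  have 2: "recfn 2 (\<lambda>xs. enc (ren (inst K [?a (xs ! 0)]) dl))"
    by (rule recfn_enc_ren_inst[of "[\<lambda>xs. ?a (xs ! 0)]" 2 K dl, simplified])
      (intro recfn_intros, simp_all)
  show "recfn2 step"
    unfolding step_def
    by (intro recfn_intros 1 2) simp_all
  show "?G n = step n (history ?G n)" for n
  proof -
    have lm: "?m n < n" "?a n < n" "?b n < n" if "?t n \<noteq> 0"
      using prod_decode_less[OF that] fst_prod_decode_le[of "?m n"] snd_prod_decode_le[of "?m n"]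
      by simp_all
    have "tr_atom (length ars) (?a n) (?b n) = enc (tr (Rel (?a n) (list_decode (?b n))))"
      using tr_atom[of "length ars" "?a n" "list_decode (?b n)"] by (simp add: prod_encode_0)
    moreover have "?l n (history ?G n) (?m n) = ?G (?m n)" "?l n (history ?G n) (?a n) = ?G (?a n)"
      "?l n (history ?G n) (?b n) = ?G (?b n)" if "?t n \<noteq> 0"
      using lm[OF that] by (simp_all only: history_lookup)
    ultimately show ?thesis
      using ars by (subst dec.simps) (simp add: step_def Let_def prod_encode_0)
  qed
qed

lemma recfn_reduct_dec: "recfn1 (\<lambda>n. enc (reduct (dec n)))"
proof -
  have "recfn1 (\<lambda>n. enc (exs qs (Conj gm (tr (dec n)))))" for qs
    by (induction qs) (auto intro!: recfn_intros recfn_tr_dec[simplified])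
  then show ?thesis
    by (simp add: reduct_def)
qed

text \<open>The semantic half: \<open>f\<close> sends each name in the definable domain to the
  element it denotes. An element may have many names; \<open>eq\<close> defines when two names
  denote the same one.\<close>

definition interprets ::
    "'a set \<Rightarrow> (nat \<Rightarrow> 'a list \<Rightarrow> bool) \<Rightarrow> 'b set \<Rightarrow> (nat \<Rightarrow> 'b list \<Rightarrow> bool) \<Rightarrow> (nat \<Rightarrow> 'b) \<Rightarrow> ('b \<Rightarrow> 'a) \<Rightarrow> bool"
  where "interprets DA IA DB IB e f \<longleftrightarrow>
    (let dom = {b \<in> DB. sat DB IB (update e [b]) dl} in
      f ` dom = DA \<and>
      (\<forall>b\<in>dom. \<forall>c\<in>dom. sat DB IB (update e [b, c]) eq = (f b = f c)) \<and>
      (\<forall>r bs. r < length ars \<longrightarrow> length bs = ars ! r \<longrightarrow> set bs \<subseteq> dom \<longrightarrow>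
        sat DB IB (update e bs) (psi r) = IA r (map f bs)))"

text \<open>Parameters live below \<open>K\<close> and translated variables at \<open>K\<close> or
  above, so the update at \<open>x + K\<close> made by a quantifier leaves the parameters intact.
  Surjectivity of \<open>f\<close> supplies a name for every witness.\<close>

lemma sat_tr:
  assumes f: "interprets DA IA DB IB e f"
    and "\<And>v. v \<in> set ps \<Longrightarrow> t v = e v"
    and "\<And>x. t (x + K) \<in> DB \<and> sat DB IB (update e [t (x + K)]) dl \<and> f (t (x + K)) = s x"
    and "wf_form sigA p"
  shows "sat DB IB t (tr p) = sat DA IA s p"
  using assms(2-4)
proof (induction p arbitrary: s t)
  case (Rel r vs)
  have r: "r < length ars" "length vs = ars ! r"
    using Rel.prems(3) by (auto simp: sigA_def split: if_splits)
  have "sat DB IB t (tr (Rel r vs)) = sat DB IB (update e (map (\<lambda>x. t (x + K)) vs)) (psi r)"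
    using sat_inst[of sigB "set ps" K vs "psi r" t e DB IB] psi[OF r(1)] r Rel.prems by simp
  also have "\<dots> = IA r (map f (map (\<lambda>x. t (x + K)) vs))"
    using f Rel.prems r by (auto simp: interprets_def Let_def image_subset_iff)
  finally show ?case
    using Rel.prems by (simp add: comp_def)
next
  case (Eq x y)
  have "sat DB IB t (tr (Eq x y)) = sat DB IB (update e (map (\<lambda>x. t (x + K)) [x, y])) eq"
    using sat_inst[of sigB "set ps" K "[x, y]" eq t e DB IB] eq Eq.prems by (simp add: numeral_2_eq_2)
  then show ?case
    using f Eq.prems by (simp add: interprets_def Let_def)
next
  case (Ex x p)
  have d: "sat DB IB (t(x + K := a)) (ren (inst K [x]) dl) = sat DB IB (update e [a]) dl" for a
  proof -
    have "x + K \<notin> set ps"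
      using dl by (auto simp: template_def)
    then show ?thesis
      using dl Ex.prems(1) by (subst sat_inst[where e = e and P = "set ps" and sig = sigB]) auto
  qed
  have IH: "sat DB IB (t(x + K := a)) (tr p) = sat DA IA (s(x := f a)) p"
    if "a \<in> DB" "sat DB IB (update e [a]) dl" for a
  proof (rule Ex.IH)
    show "(t(x + K := a)) v = e v" if "v \<in> set ps" for v
      using that dl Ex.prems(1) by (auto simp: template_def)
    show "(t(x + K := a)) (y + K) \<in> DB \<and> sat DB IB (update e [(t(x + K := a)) (y + K)]) dl \<and>
        f ((t(x + K := a)) (y + K)) = (s(x := f a)) y" for y
      using that Ex.prems(2)[of y] by auto
    show "wf_form sigA p"
      using Ex.prems by simp
  qed
  have "sat DB IB t (tr (Ex x p)) \<longleftrightarrow>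
      (\<exists>a\<in>{b \<in> DB. sat DB IB (update e [b]) dl}. sat DA IA (s(x := f a)) p)"
    using d IH by auto
  also have "\<dots> \<longleftrightarrow> (\<exists>a\<in>f ` {b \<in> DB. sat DB IB (update e [b]) dl}. sat DA IA (s(x := a)) p)"
    by blast
  also have "f ` {b \<in> DB. sat DB IB (update e [b]) dl} = DA"
    using f by (simp add: interprets_def Let_def)
  finally show ?case by (simp only: sat.simps)
next
  case (Conj p q)
  have "sat DB IB t (tr p) = sat DA IA s p"
    by (rule Conj.IH(1)) (use Conj.prems in simp_all)
  moreover have "sat DB IB t (tr q) = sat DA IA s q"
    by (rule Conj.IH(2)) (use Conj.prems in simp_all)
  ultimately show ?case by simp
next
  case (Neg p)
  have "sat DB IB t (tr p) = sat DA IA s p"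
    by (rule Neg.IH) (use Neg.prems in simp_all)
  then show ?case by simp
qed

lemma holds_closed:
  assumes "fv p = {}" "\<And>i. s i \<in> D"
  shows "holds D I p \<longleftrightarrow> sat D I s p"
  unfolding holds_def using assms sat_cong[of p] by blast

text \<open>Since every admissible choice of parameters translates truth correctly, it does not
  matter which values the existential block of \<open>reduct\<close> picks; one admissible choice
  has to exist for the block to be satisfiable.\<close>

theorem m_reducible:
  assumes DA: "DA \<noteq> {}"
    and ex: "\<exists>e. range e \<subseteq> DB \<and> sat DB IB e gm"
    and f: "\<And>e. range e \<subseteq> DB \<Longrightarrow> sat DB IB e gm \<Longrightarrow> \<exists>f. interprets DA IA DB IB e f"
  shows "m_reducible (FO sigA DA IA) (FO sigB DB IB)"
proof -
  have holds: "holds DB IB (reduct p) \<longleftrightarrow> holds DA IA p" if wf: "wf_form sigA p" and cl: "fv p = {}" for p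
  proof -
    have *: "sat DB IB e (tr p) \<longleftrightarrow> holds DA IA p" if e: "range e \<subseteq> DB" "sat DB IB e gm" for e
    proof -
      obtain f where f: "interprets DA IA DB IB e f"
        using f[OF e] by blast
      then have "f ` {b \<in> DB. sat DB IB (update e [b]) dl} = DA"
        by (simp add: interprets_def Let_def)
      then obtain b where b: "b \<in> DB" "sat DB IB (update e [b]) dl" "f b \<in> DA"
        using DA by blast
      \<comment> \<open>Keeps the parameters and lets every translated variable name the same
        element; for a closed sentence the choice of \<open>b\<close> is harmless, but some
        \<open>b\<close> is needed, which is where \<open>DA \<noteq> {}\<close> enters.\<close>
      define t where "t v = (if v < K then e v else b)" for v
      have "set ps \<subseteq> {..<K}"
        using dl by (auto simp: template_def)
      then have "v < K" if "v \<in> set ps" for v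
        using that by auto
      then have "sat DB IB t (tr p) = sat DA IA (\<lambda>_. f b) p"
        using b wf by (intro sat_tr[OF f, where s = "\<lambda>_. f b" and t = t]) (auto simp: t_def)
      moreover have "sat DB IB t (tr p) = sat DB IB e (tr p)"
        using fv_tr[OF wf] cl \<open>set ps \<subseteq> {..<K}\<close> by (intro sat_cong) (auto simp: t_def)
      ultimately show ?thesis
        using holds_closed[OF cl, of "\<lambda>_. f b"] b by simp
    qed
    obtain e0 where e0: "range e0 \<subseteq> DB" "sat DB IB e0 gm"
      using ex by blast
    have "holds DB IB (reduct p) \<longleftrightarrow> sat DB IB e0 (reduct p)"
      using fv_reduct[OF wf] cl e0 by (intro holds_closed) auto
    also have "\<dots> \<longleftrightarrow> holds DA IA p"
    proof
      assume "sat DB IB e0 (reduct p)"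
      then obtain e where e: "\<forall>v. v \<notin> set ps \<longrightarrow> e v = e0 v" "\<forall>v\<in>set ps. e v \<in> DB"
        "sat DB IB e gm" "sat DB IB e (tr p)"
        by (auto simp: reduct_def sat_exs)
      have "e v \<in> DB" for v
        using e(1,2) e0(1) by (cases "v \<in> set ps") auto
      then show "holds DA IA p"
        using * e by blast
    next
      assume "holds DA IA p"
      then show "sat DB IB e0 (reduct p)"
        using *[OF e0] e0 by (auto simp: reduct_def sat_exs intro!: exI[of _ e0])
    qed
    finally show ?thesis .
  qed
  have "x \<in> FO sigA DA IA \<longleftrightarrow> enc (reduct (dec x)) \<in> FO sigB DB IB" for x
  proof
    assume "x \<in> FO sigA DA IA"
    then obtain p where "x = enc p" "wf_form sigA p" "fv p = {}" "holds DA IA p"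
      by (auto simp: FO_def)
    then show "enc (reduct (dec x)) \<in> FO sigB DB IB"
      using holds fv_reduct by (auto simp: FO_def dec_enc wf_reduct intro!: exI[of _ "reduct p"])
  next
    \<comment> \<open>Here \<open>x\<close> is not known to be a code. Well-formedness travels back
      to \<open>dec x\<close>, and then \<open>enc_dec\<close> shows that \<open>x\<close> is
      one.\<close>
    assume "enc (reduct (dec x)) \<in> FO sigB DB IB"
    then obtain q where q: "enc q = enc (reduct (dec x))" "wf_form sigB q" "fv q = {}" "holds DB IB q"
      by (auto simp: FO_def)
    then have "q = reduct (dec x)"
      by (metis dec_enc)
    with q have wf: "wf_form sigA (dec x)"
      by (simp add: wf_reduct)
    then have "fv (dec x) = {}"
      using q fv_reduct \<open>q = _\<close> by auto
    then have "holds DA IA (dec x)"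
      using holds wf q \<open>q = _\<close> by simp
    then show "x \<in> FO sigA DA IA"
      using wf \<open>fv (dec x) = {}\<close> enc_dec[OF _ wf] ars by (auto simp: FO_def sigA_def intro!: exI[of _ "dec x"])
  qed
  then show ?thesis
    unfolding m_reducible_def using recfn_total_recursive[OF recfn_reduct_dec] by blast
qed

end

section \<open>Grids of open sets\<close>

definition clop :: "'a::real_normed_vector set \<Rightarrow> 'a set \<Rightarrow> bool" where
  "clop G A \<longleftrightarrow> open A \<and> (\<exists>B. open B \<and> A \<inter> B = {} \<and> A \<union> B = G)"

text \<open>A connected set cannot meet both halves of an open partition. Conversely, components of
  an open set are open in a locally connected space, so any family of them has an open complement in
  \<open>G\<close>.\<close>

lemma clop_iff_Union_components:
  assumes "open G"
  shows "clop G A \<longleftrightarrow> (\<exists>F \<subseteq> components G. A = \<Union>F)"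
proof
  assume "clop G A"
  then obtain B where AB: "open A" "open B" "A \<inter> B = {}" "A \<union> B = G"
    by (auto simp: clop_def)
  have "c \<subseteq> A \<or> c \<inter> A = {}" if "c \<in> components G" for c
  proof -
    have "connected c" "c \<subseteq> A \<union> B"
      using that AB in_components_connected in_components_subset by blast+
    then have "A \<inter> c = {} \<or> B \<inter> c = {}"
      using AB by (intro connectedD) auto
    then show ?thesis
      using \<open>c \<subseteq> A \<union> B\<close> by blast
  qed
  moreover have "\<exists>c\<in>components G. x \<in> c" if "x \<in> A" for x
    using that AB Union_components[of G] by blast
  ultimately have "\<exists>c\<in>components G. c \<subseteq> A \<and> x \<in> c" if "x \<in> A" for x
    using that by (metis disjoint_iff)
  then have "A = \<Union>{c \<in> components G. c \<subseteq> A}"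
    by auto
  then show "\<exists>F \<subseteq> components G. A = \<Union>F"
    by (intro exI[of _ "{c \<in> components G. c \<subseteq> A}"]) auto
next
  assume "\<exists>F \<subseteq> components G. A = \<Union>F"
  then obtain F where F: "F \<subseteq> components G" "A = \<Union>F"
    by blast
  let ?B = "\<Union>(components G - F)"
  have "open A" "open ?B"
    using F open_components[OF assms] by (auto intro!: open_Union)
  moreover have "A \<inter> ?B = {}"
    using F components_nonoverlap[of _ G] by blast
  moreover have "A \<union> ?B = \<Union>(components G)"
    using F by blast
  ultimately show "clop G A"
    using Union_components[of G] unfolding clop_def by metis
qed

lemma clop_Union_components:
  assumes "open G" "F \<subseteq> components G"
  shows "clop G (\<Union>F)"
  by (rule iffD2[OF clop_iff_Union_components[OF assms(1)]], rule exI[of _ F]) (simp add: assms(2))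

lemma clopE:
  assumes "clop G A" "open G"
  obtains F where "F \<subseteq> components G" "A = \<Union>F"
  using assms(1) unfolding clop_iff_Union_components[OF assms(2)] by (elim exE conjE) (rule that)

text \<open>Components are the atoms of the Boolean algebra of complemented elements, which makes
  them first-order definable from inclusion.\<close>

lemma components_iff_atom:
  assumes "open G"
  shows "c \<in> components G \<longleftrightarrow> clop G c \<and> c \<noteq> {} \<and> (\<forall>b. clop G b \<and> b \<subseteq> c \<and> b \<noteq> {} \<longrightarrow> c \<subseteq> b)"
proof
  assume c: "c \<in> components G"
  have "c \<subseteq> b" if "clop G b" "b \<subseteq> c" "b \<noteq> {}" for b
  proof -
    obtain F where F: "F \<subseteq> components G" "b = \<Union>F"
      using clopE \<open>clop G b\<close> assms by metis
    then obtain d x where d: "d \<in> F" "x \<in> d"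
      using \<open>b \<noteq> {}\<close> by auto
    then have "x \<in> c"
      using F \<open>b \<subseteq> c\<close> by auto
    then have "d = c"
      using F c d components_nonoverlap[of c G d] by blast
    then show ?thesis
      using d F by blast
  qed
  moreover have "clop G c"
    using clop_Union_components[OF assms, of "{c}"] c by simp
  ultimately show "clop G c \<and> c \<noteq> {} \<and> (\<forall>b. clop G b \<and> b \<subseteq> c \<and> b \<noteq> {} \<longrightarrow> c \<subseteq> b)"
    using c in_components_nonempty by blast
next
  assume c: "clop G c \<and> c \<noteq> {} \<and> (\<forall>b. clop G b \<and> b \<subseteq> c \<and> b \<noteq> {} \<longrightarrow> c \<subseteq> b)"
  then obtain F where F: "F \<subseteq> components G" "c = \<Union>F"
    using clopE assms by metis
  then obtain d where d: "d \<in> F"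
    using c by auto
  then have "clop G d" "d \<noteq> {}" "d \<subseteq> c"
    using F clop_Union_components[OF assms, of "{d}"] in_components_nonempty[of d G] by auto
  then have "c = d"
    using c by blast
  then show "c \<in> components G"
    using d F by blast
qed

text \<open>Serves to read off the components of the concrete parameters. A connected superset of
  \<open>c\<close> inside the union would be split by \<open>c\<close> and the union of the other
  members.\<close>

lemma components_Union_disjoint:
  fixes F :: "'a::real_normed_vector set set"
  assumes F: "\<And>c. c \<in> F \<Longrightarrow> open c \<and> connected c \<and> c \<noteq> {}"
    and disj: "\<And>c d. c \<in> F \<Longrightarrow> d \<in> F \<Longrightarrow> c \<noteq> d \<Longrightarrow> c \<inter> d = {}"
  shows "components (\<Union>F) = F"
proof -
  have sub: "c \<in> components (\<Union>F)" if c: "c \<in> F" for c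
  proof -
    have "T = c" if T: "T \<noteq> {}" "c \<subseteq> T" "T \<subseteq> \<Union>F" "connected T" for T
    proof -
      let ?B = "\<Union>(F - {c})"
      have "open ?B" "c \<inter> ?B = {}" "T \<subseteq> c \<union> ?B"
        using F disj[OF c] T by (auto intro!: open_Union)
      then have "c \<inter> T = {} \<or> ?B \<inter> T = {}"
        using T F[OF c] by (intro connectedD) auto
      then show ?thesis
        using T F[OF c] \<open>T \<subseteq> c \<union> ?B\<close> by blast
    qed
    then show ?thesis
      unfolding in_components_maximal using c F[OF c] by blast
  qed
  have "c \<in> F" if c: "c \<in> components (\<Union>F)" for c
  proof -
    obtain x where "x \<in> c"
      using in_components_nonempty[OF c] by blast
    then obtain d where d: "d \<in> F" "x \<in> d"
      using in_components_subset[OF c] by blast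
    then have "c = d"
      using components_nonoverlap[OF c sub[OF d(1)]] \<open>x \<in> c\<close> by blast
    then show ?thesis
      using d by simp
  qed
  then show ?thesis
    using sub by blast
qed

section \<open>Arithmetic on an abstract grid\<close>

definition same :: "'a::real_normed_vector set \<Rightarrow> 'a set \<Rightarrow> 'a set \<Rightarrow> bool" where
  "same H a b \<longleftrightarrow> (\<exists>K\<in>components H. a \<subseteq> K \<and> b \<subseteq> K)"

locale grid =
  fixes H V D G S Z :: "'a::real_normed_vector set"
  assumes open_params: "open H" "open V" "open D" "open G" "open S" "open Z"
begin

abbreviation "N \<equiv> components D"

text \<open>\<open>R\<close> is read as a set of cells; the pair \<open>(a, b)\<close> is
  represented by a cell in the row of \<open>a\<close> and the column of \<open>b\<close>.\<close>

definition rel :: "'a set \<Rightarrow> 'a set \<Rightarrow> 'a set \<Rightarrow> bool" where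
  "rel R a b \<longleftrightarrow> (\<exists>g\<in>components G. g \<subseteq> R \<and> same H g a \<and> same V g b)"

end

text \<open>The first three axioms say that every pair of numbers has a cell and that a cell
  determines its pair. \<open>not_clop\<close> separates numbers from sets, and
  \<open>col_ex\<close> makes a union of columns recoverable from its numbers. The rest are the
  Dedekind axioms for the relation coded by \<open>S\<close>. No geometry is left, so all of this
  can be said in the lattice.\<close>

locale arith_grid = grid +
  assumes pairing: "\<And>a b. a \<in> N \<Longrightarrow> b \<in> N \<Longrightarrow> \<exists>g\<in>components G. same H g a \<and> same V g b"
    and row_inj: "\<And>g a b. g \<in> components G \<Longrightarrow> a \<in> N \<Longrightarrow> b \<in> N \<Longrightarrow> same H g a \<Longrightarrow> same H g b \<Longrightarrow> a = b"
    and col_inj: "\<And>g a b. g \<in> components G \<Longrightarrow> a \<in> N \<Longrightarrow> b \<in> N \<Longrightarrow> same V g a \<Longrightarrow> same V g b \<Longrightarrow> a = b"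
    and not_clop: "\<And>a. a \<in> N \<Longrightarrow> \<not> clop V a"
    and col_ex: "\<And>v. v \<in> components V \<Longrightarrow> \<exists>a\<in>N. a \<subseteq> v"
    and Z_in: "Z \<in> N"
    and S_ex: "\<And>a. a \<in> N \<Longrightarrow> \<exists>b\<in>N. rel S a b"
    and S_fun: "\<And>a b c. a \<in> N \<Longrightarrow> b \<in> N \<Longrightarrow> c \<in> N \<Longrightarrow> rel S a b \<Longrightarrow> rel S a c \<Longrightarrow> b = c"
    and S_inj: "\<And>a b c. a \<in> N \<Longrightarrow> b \<in> N \<Longrightarrow> c \<in> N \<Longrightarrow> rel S a c \<Longrightarrow> rel S b c \<Longrightarrow> a = b"
    and S_Z: "\<And>a. a \<in> N \<Longrightarrow> \<not> rel S a Z"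
    and induct: "\<And>X a. clop V X \<Longrightarrow> Z \<subseteq> X \<Longrightarrow>
      (\<forall>a\<in>N. \<forall>b\<in>N. rel S a b \<and> a \<subseteq> X \<longrightarrow> b \<subseteq> X) \<Longrightarrow> a \<in> N \<Longrightarrow> a \<subseteq> X"
begin

text \<open>With \<open>col_ex\<close> and \<open>col_of\<close> this puts numbers and columns in
  bijection, so that a union of columns is a set of numbers.\<close>

lemma col_unique:
  assumes "a \<in> N" "b \<in> N" "v \<in> components V" "a \<subseteq> v" "b \<subseteq> v"
  shows "a = b"
proof -
  obtain g where g: "g \<in> components G" "same V g a"
    using pairing assms by blast
  then obtain w where w: "w \<in> components V" "g \<subseteq> w" "a \<subseteq> w"
    by (auto simp: same_def)
  have "a \<noteq> {}"
    using assms(1) in_components_nonempty by blast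
  then have "v = w"
    using components_nonoverlap[OF w(1) assms(3)] assms w by blast
  then have "same V g b"
    using w assms by (auto simp: same_def)
  then show ?thesis
    using g assms col_inj by blast
qed

lemma col_of: "a \<in> N \<Longrightarrow> \<exists>v\<in>components V. a \<subseteq> v"
proof -
  assume a: "a \<in> N"
  obtain g where "same V g a"
    using pairing[OF a a] by blast
  then show ?thesis
    by (auto simp: same_def)
qed

primrec num :: "nat \<Rightarrow> 'a set" where
  "num 0 = Z"
| "num (Suc n) = (SOME b. b \<in> N \<and> rel S (num n) b)"

lemma num_in: "num n \<in> N"
  and num_Suc: "rel S (num n) (num (Suc n))"
proof -
  have step: "num (Suc n) \<in> N \<and> rel S (num n) (num (Suc n))" if "num n \<in> N" for n
    using S_ex[OF that] by (auto intro: someI2_ex)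
  show in_N: "num n \<in> N" for n
    by (induction n) (use Z_in step in auto)
  show "rel S (num n) (num (Suc n))"
    using step in_N by blast
qed

declare num.simps(2) [simp del]

lemma inj_num: "inj num"
proof (rule injI)
  have ne: "num (Suc n) \<noteq> Z" for n
    using num_Suc[of n] S_Z[OF num_in[of n]] by auto
  have Suc_inj: "num m = num n" if "num (Suc m) = num (Suc n)" for m n
    using num_Suc[of m] num_Suc[of n] that S_inj[OF num_in num_in num_in] by auto
  show "m = n" if "num m = num n" for m n
    using that
  proof (induction m arbitrary: n)
    case (0 n)
    then show ?case
      using ne by (cases n) auto
  next
    case (Suc m n)
    then obtain k where "n = Suc k"
      using ne[of m] by (cases n) auto
    then show ?case
      using Suc Suc_inj[of m k] by simp
  qed
qed

definition set_of :: "nat set \<Rightarrow> 'a set" where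
  "set_of T = \<Union>{v \<in> components V. \<exists>n\<in>T. num n \<subseteq> v}"

lemma clop_set_of: "clop V (set_of T)"
  unfolding set_of_def by (rule clop_Union_components[OF open_params(2)]) auto

lemma subset_set_of:
  assumes "a \<in> N"
  shows "a \<subseteq> set_of T \<longleftrightarrow> a \<in> num ` T"
proof
  assume a: "a \<subseteq> set_of T"
  obtain v where v: "v \<in> components V" "a \<subseteq> v"
    using col_of assms by blast
  obtain x where "x \<in> a"
    using assms in_components_nonempty by blast
  then obtain w n where w: "w \<in> components V" "n \<in> T" "num n \<subseteq> w" "x \<in> w"
    using a by (auto simp: set_of_def)
  then have "v = w"
    using components_nonoverlap[OF v(1) w(1)] \<open>x \<in> a\<close> v by blast
  then show "a \<in> num ` T"
    using col_unique[OF assms num_in v] w by auto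
next
  assume "a \<in> num ` T"
  then show "a \<subseteq> set_of T"
    using col_of[OF assms] by (auto simp: set_of_def)
qed

text \<open>There are no nonstandard numbers: induction is applied to the columns of all
  \<open>num n\<close>, a legitimate instance because any union of components is
  complemented.\<close>

lemma range_num: "range num = N"
proof -
  have "a \<in> range num" if a: "a \<in> N" for a
  proof -
    have "a \<subseteq> set_of UNIV"
    proof (rule induct[OF clop_set_of _ _ a])
      show "Z \<subseteq> set_of UNIV"
        using subset_set_of[OF Z_in] by (metis num.simps(1) rangeI)
      show "\<forall>a\<in>N. \<forall>b\<in>N. rel S a b \<and> a \<subseteq> set_of UNIV \<longrightarrow> b \<subseteq> set_of UNIV"
      proof (intro ballI impI)
        fix a b assume ab: "a \<in> N" "b \<in> N" "rel S a b \<and> a \<subseteq> set_of UNIV"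
        then obtain n where "a = num n"
          using subset_set_of[of a] by blast
        then have "b = num (Suc n)"
          using ab S_fun[OF num_in _ num_in _ num_Suc] by simp
        then show "b \<subseteq> set_of UNIV"
          using subset_set_of[OF ab(2)] by blast
      qed
    qed
    then show ?thesis
      using subset_set_of[OF a] by simp
  qed
  then show ?thesis
    using num_in by auto
qed

lemma rel_S_num: "rel S (num m) (num n) \<longleftrightarrow> n = Suc m"
proof
  assume "rel S (num m) (num n)"
  then have "num (Suc m) = num n"
    by (rule S_fun[OF num_in num_in num_in num_Suc])
  then show "n = Suc m"
    using injD[OF inj_num] by auto
qed (simp add: num_Suc)

lemma eq_set_of:
  assumes "clop V X"
  shows "X = set_of {n. num n \<subseteq> X}"
proof -
  obtain F where F: "F \<subseteq> components V" "X = \<Union>F"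
    using clopE[OF assms open_params(2)] .
  have "v \<in> F \<longleftrightarrow> v \<in> components V \<and> (\<exists>n. num n \<subseteq> X \<and> num n \<subseteq> v)" for v
  proof
    assume v: "v \<in> F"
    then obtain a where "a \<in> N" "a \<subseteq> v"
      using F col_ex by blast
    moreover from this obtain n where "a = num n"
      using range_num by blast
    moreover have "v \<subseteq> X"
      using v F by blast
    ultimately show "v \<in> components V \<and> (\<exists>n. num n \<subseteq> X \<and> num n \<subseteq> v)"
      using v F by blast
  next
    assume "v \<in> components V \<and> (\<exists>n. num n \<subseteq> X \<and> num n \<subseteq> v)"
    then obtain n where n: "v \<in> components V" "num n \<subseteq> X" "num n \<subseteq> v"
      by blast
    obtain x where "x \<in> num n"
      using num_in in_components_nonempty by blast
    then obtain w where "w \<in> F" "x \<in> w"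
      using n F by blast
    then show "v \<in> F"
      using n F components_nonoverlap[OF n(1), of w] \<open>x \<in> num n\<close> by blast
  qed
  then have "F = {v \<in> components V. \<exists>n\<in>{n. num n \<subseteq> X}. num n \<subseteq> v}"
    by auto
  then have "\<Union>F = set_of {n. num n \<subseteq> X}"
    unfolding set_of_def by (rule arg_cong)
  then show ?thesis
    using F by simp
qed

lemma clop_V_iff: "clop V X \<longleftrightarrow> X \<in> range set_of"
  using eq_set_of[of X] clop_set_of by auto

definition code :: "(nat \<Rightarrow> nat \<Rightarrow> bool) \<Rightarrow> 'a set" where
  "code r = \<Union>{g \<in> components G. \<exists>i j. r i j \<and> same H g (num i) \<and> same V g (num j)}"

lemma clop_code: "clop G (code r)"
  unfolding code_def by (rule clop_Union_components[OF open_params(4)]) auto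

text \<open>A cell may belong to \<open>code r\<close> on account of another pair
  \<open>(k, l)\<close>; \<open>row_inj\<close> and \<open>col_inj\<close> identify that pair with
  \<open>(i, j)\<close>.\<close>

lemma rel_code: "rel (code r) (num i) (num j) \<longleftrightarrow> r i j"
proof
  assume "rel (code r) (num i) (num j)"
  then obtain g where g: "g \<in> components G" "g \<subseteq> code r" "same H g (num i)" "same V g (num j)"
    by (auto simp: rel_def)
  obtain x where "x \<in> g"
    using g in_components_nonempty by blast
  then obtain h k l where h: "h \<in> components G" "r k l" "same H h (num k)" "same V h (num l)" "x \<in> h"
    using g by (auto simp: code_def)
  have "h = g"
    using components_nonoverlap[OF h(1) g(1)] \<open>x \<in> g\<close> h by blast
  then have "num i = num k" "num j = num l"
    using g h row_inj[OF g(1) num_in num_in] col_inj[OF g(1) num_in num_in] by auto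
  then show "r i j"
    using h inj_num by (metis injD)
next
  assume "r i j"
  then show "rel (code r) (num i) (num j)"
    using pairing[OF num_in[of i] num_in[of j]] by (auto simp: rel_def code_def)
qed

text \<open>Turns a quantifier over open sets into one over all binary relations on the natural
  numbers, after which the geometry disappears from the computation of \<open>add\<close> and
  \<open>mult\<close>.\<close>

lemma all_clop_G_iff:
  "(\<forall>R. clop G R \<longrightarrow> P (\<lambda>i j. rel R (num i) (num j))) \<longleftrightarrow> (\<forall>r. P r)"
proof
  assume L: "\<forall>R. clop G R \<longrightarrow> P (\<lambda>i j. rel R (num i) (num j))"
  show "\<forall>r. P r"
  proof
    fix r
    have "P (\<lambda>i j. rel (code r) (num i) (num j))"
      using L clop_code by blast
    then show "P r"
      by (simp add: rel_code)
  qed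
qed blast

text \<open>Only binary relations can be coded, so \<open>x\<close> is held fixed and the least
  relation is the graph of adding \<open>x\<close>. \<open>mult\<close> treats its first factor in
  the same way.\<close>

definition add :: "'a set \<Rightarrow> 'a set \<Rightarrow> 'a set \<Rightarrow> bool" where
  "add x y z \<longleftrightarrow> (\<forall>R. clop G R \<longrightarrow> rel R Z x \<longrightarrow>
    (\<forall>u\<in>N. \<forall>u'\<in>N. \<forall>v\<in>N. \<forall>v'\<in>N. rel S u u' \<longrightarrow> rel S v v' \<longrightarrow> rel R u v \<longrightarrow> rel R u' v') \<longrightarrow> rel R y z)"

definition mult :: "'a set \<Rightarrow> 'a set \<Rightarrow> 'a set \<Rightarrow> bool" where
  "mult x y z \<longleftrightarrow> (\<forall>R. clop G R \<longrightarrow> rel R Z Z \<longrightarrow>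
    (\<forall>u\<in>N. \<forall>u'\<in>N. \<forall>v\<in>N. \<forall>w\<in>N. rel S u u' \<longrightarrow> add v x w \<longrightarrow> rel R u v \<longrightarrow> rel R u' w) \<longrightarrow> rel R y z)"

lemma add_num: "add (num i) (num j) (num k) \<longleftrightarrow> k = i + j"
proof -
  have "add (num i) (num j) (num k) \<longleftrightarrow> (\<forall>R. clop G R \<longrightarrow> rel R (num 0) (num i) \<longrightarrow>
      (\<forall>m n. rel R (num m) (num n) \<longrightarrow> rel R (num (Suc m)) (num (Suc n))) \<longrightarrow> rel R (num j) (num k))"
    unfolding add_def range_num[symmetric] by (simp add: rel_S_num)
  also have "\<dots> \<longleftrightarrow> (\<forall>r. r 0 i \<longrightarrow> (\<forall>m n. r m n \<longrightarrow> r (Suc m) (Suc n)) \<longrightarrow> r j k)"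
    by (rule all_clop_G_iff)
  also have "\<dots> \<longleftrightarrow> k = i + j"
  proof
    assume "\<forall>r. r 0 i \<longrightarrow> (\<forall>m n. r m n \<longrightarrow> r (Suc m) (Suc n)) \<longrightarrow> r j k"
    from this[rule_format, of "\<lambda>m n. n = i + m"] show "k = i + j"
      by simp
  next
    have "r j (i + j)" if "r 0 i" "\<forall>m n. r m n \<longrightarrow> r (Suc m) (Suc n)" for r
      using that by (induction j) auto
    then show "\<forall>r. r 0 i \<longrightarrow> (\<forall>m n. r m n \<longrightarrow> r (Suc m) (Suc n)) \<longrightarrow> r j k" if "k = i + j"
      using that by blast
  qed
  finally show ?thesis .
qed

lemma mult_num: "mult (num i) (num j) (num k) \<longleftrightarrow> k = i * j"
proof -
  have "mult (num i) (num j) (num k) \<longleftrightarrow> (\<forall>R. clop G R \<longrightarrow> rel R (num 0) (num 0) \<longrightarrow>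
      (\<forall>m n. rel R (num m) (num n) \<longrightarrow> rel R (num (Suc m)) (num (n + i))) \<longrightarrow> rel R (num j) (num k))"
    unfolding mult_def range_num[symmetric] by (simp add: rel_S_num add_num)
  also have "\<dots> \<longleftrightarrow> (\<forall>r. r 0 0 \<longrightarrow> (\<forall>m n. r m n \<longrightarrow> r (Suc m) (n + i)) \<longrightarrow> r j k)"
    by (rule all_clop_G_iff)
  also have "\<dots> \<longleftrightarrow> k = i * j"
  proof
    assume "\<forall>r. r 0 0 \<longrightarrow> (\<forall>m n. r m n \<longrightarrow> r (Suc m) (n + i)) \<longrightarrow> r j k"
    from this[rule_format, of "\<lambda>m n. n = i * m"] show "k = i * j"
      by simp
  next
    have "r j (i * j)" if "r 0 0" "\<forall>m n. r m n \<longrightarrow> r (Suc m) (n + i)" for r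
      using that by (induction j) (auto, metis add.commute)
    then show "\<forall>r. r 0 0 \<longrightarrow> (\<forall>m n. r m n \<longrightarrow> r (Suc m) (n + i)) \<longrightarrow> r j k" if "k = i * j"
      using that by blast
  qed
  finally show ?thesis .
qed

definition decode :: "'a set \<Rightarrow> nat + nat set" where
  "decode x = (if x \<in> N then Inl (inv num x) else Inr {n. num n \<subseteq> x})"

lemma decode_num [simp]: "decode (num n) = Inl n"
  using num_in inj_num by (simp add: decode_def)

lemma decode_set_of [simp]: "decode (set_of T) = Inr T"
proof -
  have "set_of T \<notin> N"
    using not_clop clop_set_of by blast
  then show ?thesis
    by (simp add: decode_def subset_set_of[OF num_in] inj_image_mem_iff[OF inj_num])
qed

end

section \<open>A concrete grid in dimension at least two\<close>

definition slab :: "'n \<Rightarrow> nat \<Rightarrow> (real ^ 'n) set" where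
  "slab k i = {v. \<bar>v $ k - real i\<bar> < 1 / 3}"

lemma open_slab: "open (slab k i)"
  unfolding slab_def by (intro open_Collect_less continuous_intros)

lemma convex_slab: "convex (slab k i)"
proof -
  have "\<bar>x - real i\<bar> < 1 / 3 \<longleftrightarrow> x < real i + 1 / 3 \<and> x > real i - 1 / 3" for x
    by linarith
  then have "slab k i = {v. axis k 1 \<bullet> v < real i + 1 / 3} \<inter> {v. axis k 1 \<bullet> v > real i - 1 / 3}"
    by (auto simp only: slab_def inner_axis' inner_real_def mult_1)
  then show ?thesis
    by (simp add: convex_Int convex_halfspace_lt convex_halfspace_gt)
qed

text \<open>The half-width \<open>1 / 3\<close> is below \<open>1 / 2\<close>, half the distance of
  neighbouring centres.\<close>

lemma slab_disjoint: "slab k i \<inter> slab k j \<noteq> {} \<Longrightarrow> i = j"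
proof -
  assume "slab k i \<inter> slab k j \<noteq> {}"
  then obtain v where "\<bar>v $ k - real i\<bar> < 1 / 3" "\<bar>v $ k - real j\<bar> < 1 / 3"
    unfolding slab_def by blast
  then show "i = j"
    by linarith
qed

lemma exists_arith_grid:
  assumes "CARD('n) \<ge> 2"
  shows "\<exists>H V D G S Z :: (real ^ 'n) set. arith_grid H V D G S Z"
proof -
  obtain a b :: 'n where "a \<noteq> b"
    using assms card_le_Suc0_iff_eq[of "UNIV :: 'n set"] by fastforce
  define cell where "cell i j = slab a i \<inter> slab b j" for i j
  have cell_ne: "cell i j \<noteq> {}" for i j
  proof -
    have "(\<chi> k. if k = a then real i else real j) \<in> cell i j"
      using \<open>a \<noteq> b\<close> by (simp add: cell_def slab_def)
    then show ?thesis by blast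
  qed
  have slab_ne: "slab a i \<noteq> {}" "slab b j \<noteq> {}" for i j
    using cell_ne[of i j] by (auto simp: cell_def)
  have cell_slab: "cell i j \<subseteq> slab a k \<longleftrightarrow> i = k" "cell i j \<subseteq> slab b k \<longleftrightarrow> j = k" for i j k
    using cell_ne[of i j] slab_disjoint[of a i k] slab_disjoint[of b j k] by (auto simp: cell_def)
  have cell_disj: "i = k \<and> j = l" if "cell i j \<inter> cell k l \<noteq> {}" for i j k l
    using that slab_disjoint[of a i k] slab_disjoint[of b j l] by (auto simp: cell_def)
  have cell_inj: "cell i j = cell k l \<longleftrightarrow> i = k \<and> j = l" for i j k l
    using cell_disj[of i j k l] cell_ne[of i j] by auto
  have cell: "open (cell i j) \<and> connected (cell i j) \<and> cell i j \<noteq> {}" for i j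
    using cell_ne by (auto simp: cell_def open_slab convex_slab intro!: open_Int convex_connected convex_Int)
  have slab: "open (slab k i) \<and> connected (slab k i)" for k and i :: nat
    by (simp add: open_slab convex_slab convex_connected)
  define H where "H = (\<Union>i. slab a i)"
  define V where "V = (\<Union>i. slab b i)"
  define G where "G = (\<Union>(i, j). cell i j)"
  define D where "D = (\<Union>i. cell i i)"
  \<comment> \<open>The cells just off the diagonal: the row of \<open>i\<close> crossed with the
    column of \<open>Suc i\<close>.\<close>
  define S where "S = (\<Union>i. cell i (Suc i))"
  have comps: "components H = range (slab a)" "components V = range (slab b)"
    unfolding H_def V_def
    by (rule components_Union_disjoint, use slab slab_ne in auto; use slab_disjoint in blast)+
  have comps2: "components G = range (\<lambda>(i, j). cell i j)" "components D = range (\<lambda>i. cell i i)"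
    unfolding G_def D_def
    by (rule components_Union_disjoint, use cell in auto; use cell_disj in blast)+
  note comps = comps comps2
  have opens: "open H" "open V" "open D" "open G" "open S"
    unfolding H_def V_def G_def D_def S_def using slab cell by (auto intro!: open_UN)
  interpret grid H V D G S "cell 0 0"
    using opens cell by unfold_locales auto
  have same: "same H (cell i j) (cell k l) \<longleftrightarrow> i = k" "same V (cell i j) (cell k l) \<longleftrightarrow> j = l"
    for i j k l
    by (auto simp: same_def comps cell_slab)
  have cell_S: "cell i j \<subseteq> S \<longleftrightarrow> j = Suc i" for i j
  proof
    assume "cell i j \<subseteq> S"
    moreover obtain x where "x \<in> cell i j"
      using cell_ne by blast
    ultimately obtain k where "x \<in> cell k (Suc k)"
      by (auto simp: S_def)
    then show "j = Suc i"
      using cell_disj[of i j k "Suc k"] \<open>x \<in> cell i j\<close> by blast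
  qed (auto simp: S_def)
  have rel_iff: "rel S (cell i i) (cell j j) \<longleftrightarrow> j = Suc i" for i j
    by (auto simp: rel_def comps same cell_S)
  have "arith_grid H V D G S (cell 0 0)"
  proof
    fix x y
    assume "x \<in> N" "y \<in> N"
    then show "\<exists>g\<in>components G. same H g x \<and> same V g y"
      by (auto simp: comps same)
  next
    fix g x y
    assume "g \<in> components G" "x \<in> N" "y \<in> N" "same H g x" "same H g y"
    then show "x = y"
      by (auto simp: comps same)
  next
    fix g x y
    assume "g \<in> components G" "x \<in> N" "y \<in> N" "same V g x" "same V g y"
    then show "x = y"
      by (auto simp: comps same)
  next
    fix x
    assume "x \<in> N"
    then obtain i where x: "x = cell i i"
      by (auto simp: comps)
    show "\<not> clop V x"
    proof
      assume "clop V x"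
      then obtain F where F: "F \<subseteq> components V" "x = \<Union>F"
        using clopE opens by metis
      then obtain v where "v \<in> F"
        using x cell_ne[of i i] by auto
      then obtain j where j: "v = slab b j"
        using F(1) \<open>v \<in> F\<close> by (auto simp: comps)
      \<comment> \<open>A column crosses every row and therefore does not fit into a single cell;
        the row \<open>Suc i\<close> witnesses this.\<close>
      have "cell (Suc i) j \<subseteq> slab b j"
        by (simp add: cell_def)
      also have "\<dots> \<subseteq> cell i i"
        using F(2) \<open>v \<in> F\<close> j x by auto
      finally show False
        using cell_slab(1)[of "Suc i" j i] by (auto simp: cell_def)
    qed
  next
    fix v
    assume "v \<in> components V"
    then obtain j where "v = slab b j"
      by (auto simp: comps)
    then show "\<exists>x\<in>N. x \<subseteq> v"
      by (auto simp: comps cell_def)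
  next
    show "cell 0 0 \<in> N"
      by (auto simp: comps)
  next
    fix x
    assume "x \<in> N"
    then show "\<exists>y\<in>N. rel S x y"
      by (auto simp: comps rel_iff)
  next
    fix x y z
    assume "x \<in> N" "y \<in> N" "z \<in> N" "rel S x y" "rel S x z"
    then show "y = z"
      by (auto simp: comps rel_iff)
  next
    fix x y z
    assume "x \<in> N" "y \<in> N" "z \<in> N" "rel S x z" "rel S y z"
    then show "x = y"
      by (auto simp: comps rel_iff)
  next
    fix x
    assume "x \<in> N"
    then show "\<not> rel S x (cell 0 0)"
      by (auto simp: comps rel_iff)
  next
    fix X x
    assume X: "cell 0 0 \<subseteq> X" "\<forall>x\<in>N. \<forall>y\<in>N. rel S x y \<and> x \<subseteq> X \<longrightarrow> y \<subseteq> X" and "x \<in> N"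
    have "cell n n \<subseteq> X" for n
    proof (induction n)
      case (Suc n)
      then show ?case
        using X(2)[rule_format, of "cell n n" "cell (Suc n) (Suc n)"] rel_iff by (auto simp: comps)
    qed (rule X)
    then show "x \<subseteq> X"
      using \<open>x \<in> N\<close> by (auto simp: comps)
  qed
  then show ?thesis
    by blast
qed

section \<open>Arithmetic in the lattice of open sets\<close>

abbreviation lsat :: "(nat \<Rightarrow> (real ^ 'n) set) \<Rightarrow> form \<Rightarrow> bool" where
  "lsat \<equiv> sat open_lattice_dom subset_rel"

lemma Bex_open_lattice_dom [simp]: "(\<exists>a\<in>open_lattice_dom. P a) \<longleftrightarrow> (\<exists>a. open a \<and> P a)"
  by (auto simp: open_lattice_dom_def)

lemma Ball_open_lattice_dom [simp]: "(\<forall>a\<in>open_lattice_dom. P a) \<longleftrightarrow> (\<forall>a. open a \<longrightarrow> P a)"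
  by (auto simp: open_lattice_dom_def)

definition valid :: "(nat \<Rightarrow> (real ^ 'n) set) \<Rightarrow> bool" where
  "valid s \<longleftrightarrow> (\<forall>v. open (s v))"

lemma valid_open [simp]: "valid s \<Longrightarrow> open (s v)"
  by (simp add: valid_def)

lemma valid_upd [simp]: "valid s \<Longrightarrow> valid (s(v := a)) \<longleftrightarrow> open a"
  by (auto simp: valid_def split: if_splits)

lemma open_component: "c \<in> components S \<Longrightarrow> open S \<Longrightarrow> open (c :: (real ^ 'n) set)"
  by (rule open_components)

abbreviation subF :: "nat \<Rightarrow> nat \<Rightarrow> form" where
  "subF x y \<equiv> Rel 0 [x, y]"

text \<open>In this and the following macros \<open>b\<close> is the index from which auxiliary
  bound variables are taken; the side conditions \<open>x < b\<close> keep them away from the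
  arguments.\<close>

definition emptyF :: "nat \<Rightarrow> nat \<Rightarrow> form" where
  "emptyF x b = FAll b (subF x b)"

lemma sat_emptyF [simp]: "x < b \<Longrightarrow> lsat s (emptyF x b) \<longleftrightarrow> s x = {}"
  by (auto simp: emptyF_def dest!: spec[of _ "{}"])

definition disjF :: "nat \<Rightarrow> nat \<Rightarrow> nat \<Rightarrow> form" where
  "disjF x y b = FAll b (FImp (Conj (subF b x) (subF b y)) (emptyF b (Suc b)))"

text \<open>Only open test sets are available, but the intersection is itself one of them; for
  \<open>unionF\<close> the union plays this part.\<close>

lemma sat_disjF [simp]:
  assumes "valid s" "x < b" "y < b"
  shows "lsat s (disjF x y b) \<longleftrightarrow> s x \<inter> s y = {}"
proof -
  have "lsat s (disjF x y b) \<longleftrightarrow> (\<forall>a. open a \<and> a \<subseteq> s x \<and> a \<subseteq> s y \<longrightarrow> a = {})"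
    using assms by (auto simp: disjF_def)
  also have "\<dots> \<longleftrightarrow> s x \<inter> s y = {}"
  proof
    assume L: "\<forall>a. open a \<and> a \<subseteq> s x \<and> a \<subseteq> s y \<longrightarrow> a = {}"
    have "open (s x \<inter> s y)"
      using assms(1) by (simp add: open_Int)
    then show "s x \<inter> s y = {}"
      using L by simp
  qed auto
  finally show ?thesis .
qed

definition unionF :: "nat \<Rightarrow> nat \<Rightarrow> nat \<Rightarrow> nat \<Rightarrow> form" where
  "unionF x y z b = Conj (Conj (subF x z) (subF y z))
     (FAll b (FImp (Conj (subF x b) (subF y b)) (subF z b)))"

lemma sat_unionF [simp]:
  assumes "valid s" "x < b" "y < b" "z < b"
  shows "lsat s (unionF x y z b) \<longleftrightarrow> s x \<union> s y = s z"
proof -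
  have "lsat s (unionF x y z b) \<longleftrightarrow> s x \<subseteq> s z \<and> s y \<subseteq> s z \<and>
      (\<forall>a. open a \<and> s x \<subseteq> a \<and> s y \<subseteq> a \<longrightarrow> s z \<subseteq> a)"
    using assms by (auto simp: unionF_def)
  also have "\<dots> \<longleftrightarrow> s x \<union> s y = s z"
  proof
    assume L: "s x \<subseteq> s z \<and> s y \<subseteq> s z \<and> (\<forall>a. open a \<and> s x \<subseteq> a \<and> s y \<subseteq> a \<longrightarrow> s z \<subseteq> a)"
    have "open (s x \<union> s y)"
      using assms(1) by (simp add: open_Un)
    then have "s z \<subseteq> s x \<union> s y"
      using L by simp
    then show "s x \<union> s y = s z"
      using L by auto
  qed auto
  finally show ?thesis .
qed

definition clopF :: "nat \<Rightarrow> nat \<Rightarrow> nat \<Rightarrow> form" where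
  "clopF x g b = Ex b (Conj (disjF x b (Suc b)) (unionF x b g (Suc b)))"

lemma sat_clopF [simp]:
  "valid s \<Longrightarrow> x < b \<Longrightarrow> g < b \<Longrightarrow> lsat s (clopF x g b) \<longleftrightarrow> clop (s g) (s x)"
  by (simp add: clopF_def clop_def cong: conj_cong)

definition compF :: "nat \<Rightarrow> nat \<Rightarrow> nat \<Rightarrow> form" where
  "compF x g b = Conj (Conj (clopF x g b) (Neg (emptyF x b)))
     (FAll b (FImp (Conj (Conj (clopF b g (Suc b)) (subF b x)) (Neg (emptyF b (Suc b)))) (subF x b)))"

lemma sat_compF [simp]:
  assumes "valid s" "x < b" "g < b"
  shows "lsat s (compF x g b) \<longleftrightarrow> s x \<in> components (s g)"
proof -
  have "lsat s (compF x g b) \<longleftrightarrow> clop (s g) (s x) \<and> s x \<noteq> {} \<and>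
     (\<forall>a. open a \<longrightarrow> clop (s g) a \<and> a \<subseteq> s x \<and> a \<noteq> {} \<longrightarrow> s x \<subseteq> a)"
    using assms by (simp add: compF_def cong: conj_cong imp_cong)
  also have "\<dots> \<longleftrightarrow> s x \<in> components (s g)"
    using assms(1) components_iff_atom[of "s g" "s x"] by (auto simp: clop_def)
  finally show ?thesis .
qed

definition AllC :: "nat \<Rightarrow> nat \<Rightarrow> nat \<Rightarrow> form \<Rightarrow> form" where
  "AllC x g b p = FAll x (FImp (compF x g b) p)"

definition ExC :: "nat \<Rightarrow> nat \<Rightarrow> nat \<Rightarrow> form \<Rightarrow> form" where
  "ExC x g b p = Ex x (Conj (compF x g b) p)"

lemma sat_AllC [simp]:
  assumes "valid s" "x < b" "g < b" "x \<noteq> g"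
  shows "lsat s (AllC x g b p) \<longleftrightarrow> (\<forall>a\<in>components (s g). lsat (s(x := a)) p)"
proof -
  have "lsat s (AllC x g b p) \<longleftrightarrow> (\<forall>a. open a \<longrightarrow> a \<in> components (s g) \<longrightarrow> lsat (s(x := a)) p)"
    using assms by (simp add: AllC_def cong: conj_cong imp_cong)
  then show ?thesis
    using assms open_component[of _ "s g"] by auto
qed

lemma sat_ExC [simp]:
  assumes "valid s" "x < b" "g < b" "x \<noteq> g"
  shows "lsat s (ExC x g b p) \<longleftrightarrow> (\<exists>a\<in>components (s g). lsat (s(x := a)) p)"
proof -
  have "lsat s (ExC x g b p) \<longleftrightarrow> (\<exists>a. open a \<and> a \<in> components (s g) \<and> lsat (s(x := a)) p)"
    using assms by (simp add: ExC_def cong: conj_cong)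
  then show ?thesis
    using assms open_component[of _ "s g"] by auto
qed

definition AllP :: "nat \<Rightarrow> nat \<Rightarrow> nat \<Rightarrow> form \<Rightarrow> form" where
  "AllP x g b p = FAll x (FImp (clopF x g b) p)"

lemma sat_AllP [simp]:
  assumes "valid s" "x < b" "g < b" "x \<noteq> g"
  shows "lsat s (AllP x g b p) \<longleftrightarrow> (\<forall>a. clop (s g) a \<longrightarrow> lsat (s(x := a)) p)"
proof -
  have "lsat s (AllP x g b p) \<longleftrightarrow> (\<forall>a. open a \<longrightarrow> clop (s g) a \<longrightarrow> lsat (s(x := a)) p)"
    using assms by (simp add: AllP_def cong: conj_cong imp_cong)
  then show ?thesis
    by (auto simp: clop_def)
qed

definition sameF :: "nat \<Rightarrow> nat \<Rightarrow> nat \<Rightarrow> nat \<Rightarrow> form" where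
  "sameF h x y b = ExC b h (Suc b) (Conj (subF x b) (subF y b))"

lemma sat_sameF [simp]:
  "valid s \<Longrightarrow> h < b \<Longrightarrow> x < b \<Longrightarrow> y < b \<Longrightarrow> lsat s (sameF h x y b) \<longleftrightarrow> same (s h) (s x) (s y)"
  by (simp add: sameF_def same_def)

text \<open>The variables \<open>3, \<dots>, 8\<close> hold the parameters \<open>H, V, D, G, S, Z\<close>.\<close>

definition relF :: "nat \<Rightarrow> nat \<Rightarrow> nat \<Rightarrow> nat \<Rightarrow> form" where
  "relF r x y b = ExC b 6 (Suc b) (Conj (subF b r) (Conj (sameF 3 b x (Suc b)) (sameF 4 b y (Suc b))))"

abbreviation grid_of :: "(nat \<Rightarrow> (real ^ 'n) set) \<Rightarrow> bool" where
  "grid_of s \<equiv> arith_grid (s 3) (s 4) (s 5) (s 6) (s 7) (s 8)"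

abbreviation "rel_of s \<equiv> grid.rel (s 3) (s 4) (s (6::nat))"

lemma valid_grid: "valid s \<Longrightarrow> grid (s 3) (s 4) (s 5) (s 6) (s 7) (s 8)"
  by unfold_locales auto

lemma sat_relF [simp]:
  assumes "valid s" "9 \<le> b" "r < b" "x < b" "y < b"
  shows "lsat s (relF r x y b) \<longleftrightarrow> rel_of s (s r) (s x) (s y)"
  using assms open_component[of _ "s 6"]
  by (simp add: relF_def grid.rel_def[OF valid_grid] cong: bex_cong conj_cong)

text \<open>Its bound variables start at \<open>20\<close> because \<open>multF\<close>, whose own
  start at \<open>10\<close>, calls it with arguments below \<open>20\<close>.\<close>

definition addF :: "nat \<Rightarrow> nat \<Rightarrow> nat \<Rightarrow> form" where
  "addF x y z = AllP 20 6 21 (FImp (relF 20 8 x 21) (FImp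
     (AllC 21 5 25 (AllC 22 5 25 (AllC 23 5 25 (AllC 24 5 25
       (FImp (relF 7 21 22 25) (FImp (relF 7 23 24 25)
         (FImp (relF 20 21 23 25) (relF 20 22 24 25))))))))
     (relF 20 y z 25)))"

abbreviation "add_of s \<equiv> arith_grid.add (s 3) (s 4) (s 5) (s 6) (s 7) (s (8::nat))"
abbreviation "mult_of s \<equiv> arith_grid.mult (s 3) (s 4) (s 5) (s 6) (s 7) (s (8::nat))"

lemma open_clop: "clop S a \<Longrightarrow> open a"
  by (simp add: clop_def)

lemma sat_addF [simp]:
  assumes "valid s" "grid_of s" "x < 20" "y < 20" "z < 20"
  shows "lsat s (addF x y z) \<longleftrightarrow> add_of s (s x) (s y) (s z)"
  using assms open_component[of _ "s 5"] open_clop[of "s 6"]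
  by (simp add: addF_def arith_grid.add_def cong: ball_cong imp_cong)

definition multF :: "nat \<Rightarrow> nat \<Rightarrow> nat \<Rightarrow> form" where
  "multF x y z = AllP 10 6 11 (FImp (relF 10 8 8 11) (FImp
     (AllC 11 5 15 (AllC 12 5 15 (AllC 13 5 15 (AllC 14 5 15
       (FImp (relF 7 11 12 15) (FImp (addF 13 x 14)
         (FImp (relF 10 11 13 15) (relF 10 12 14 15))))))))
     (relF 10 y z 15)))"

lemma sat_multF [simp]:
  assumes "valid s" "grid_of s" "x < 10" "y < 10" "z < 10"
  shows "lsat s (multF x y z) \<longleftrightarrow> mult_of s (s x) (s y) (s z)"
  using assms open_component[of _ "s 5"] open_clop[of "s 6"]
  by (simp add: multF_def arith_grid.mult_def cong: ball_cong imp_cong)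

text \<open>The axioms of \<open>arith_grid\<close> in the order of the locale. Openness of the
  parameters is automatic, as assignments take values in the lattice.\<close>

definition goodF :: form where
  "goodF = foldr Conj [
     AllC 9 5 12 (AllC 10 5 12 (ExC 11 6 12 (Conj (sameF 3 11 9 12) (sameF 4 11 10 12)))),
     AllC 11 6 12 (AllC 9 5 12 (AllC 10 5 12 (FImp (sameF 3 11 9 12) (FImp (sameF 3 11 10 12) (Eq 9 10))))),
     AllC 11 6 12 (AllC 9 5 12 (AllC 10 5 12 (FImp (sameF 4 11 9 12) (FImp (sameF 4 11 10 12) (Eq 9 10))))),
     AllC 9 5 10 (Neg (clopF 9 4 10)),
     AllC 9 4 10 (ExC 10 5 11 (subF 10 9)),
     compF 8 5 9,
     AllC 9 5 11 (ExC 10 5 11 (relF 7 9 10 11)),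
     AllC 9 5 12 (AllC 10 5 12 (AllC 11 5 12 (FImp (relF 7 9 10 12) (FImp (relF 7 9 11 12) (Eq 10 11))))),
     AllC 9 5 12 (AllC 10 5 12 (AllC 11 5 12 (FImp (relF 7 9 11 12) (FImp (relF 7 10 11 12) (Eq 9 10))))),
     AllC 9 5 10 (Neg (relF 7 9 8 10))]
     (AllP 9 4 10 (FImp (subF 8 9) (FImp
       (AllC 10 5 12 (AllC 11 5 12 (FImp (Conj (relF 7 10 11 12) (subF 10 9)) (subF 11 9))))
       (AllC 10 5 11 (subF 10 9)))))"

lemma sat_goodF:
  assumes "valid s"
  shows "lsat s goodF \<longleftrightarrow> grid_of s"
proof -
  note oc = open_component[of _ "s 4"] open_component[of _ "s 5"] open_component[of _ "s 6"] open_clop[of "s 4"]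
  have "lsat s goodF \<longleftrightarrow>
    (\<forall>a\<in>components (s 5). \<forall>b\<in>components (s 5). \<exists>g\<in>components (s 6). same (s 3) g a \<and> same (s 4) g b) \<and>
    (\<forall>g\<in>components (s 6). \<forall>a\<in>components (s 5). \<forall>b\<in>components (s 5). same (s 3) g a \<longrightarrow> same (s 3) g b \<longrightarrow> a = b) \<and>
    (\<forall>g\<in>components (s 6). \<forall>a\<in>components (s 5). \<forall>b\<in>components (s 5). same (s 4) g a \<longrightarrow> same (s 4) g b \<longrightarrow> a = b) \<and>
    (\<forall>a\<in>components (s 5). \<not> clop (s 4) a) \<and>
    (\<forall>v\<in>components (s 4). \<exists>a\<in>components (s 5). a \<subseteq> v) \<and>
    s 8 \<in> components (s 5) \<and>
    (\<forall>a\<in>components (s 5). \<exists>b\<in>components (s 5). rel_of s (s 7) a b) \<and>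
    (\<forall>a\<in>components (s 5). \<forall>b\<in>components (s 5). \<forall>c\<in>components (s 5).
      rel_of s (s 7) a b \<longrightarrow> rel_of s (s 7) a c \<longrightarrow> b = c) \<and>
    (\<forall>a\<in>components (s 5). \<forall>b\<in>components (s 5). \<forall>c\<in>components (s 5).
      rel_of s (s 7) a c \<longrightarrow> rel_of s (s 7) b c \<longrightarrow> a = b) \<and>
    (\<forall>a\<in>components (s 5). \<not> rel_of s (s 7) a (s 8)) \<and>
    (\<forall>X. clop (s 4) X \<longrightarrow> s 8 \<subseteq> X \<longrightarrow> (\<forall>a\<in>components (s 5). \<forall>b\<in>components (s 5).
      rel_of s (s 7) a b \<and> a \<subseteq> X \<longrightarrow> b \<subseteq> X) \<longrightarrow> (\<forall>a\<in>components (s 5). a \<subseteq> X))"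
    using assms oc by (simp add: goodF_def cong: ball_cong bex_cong imp_cong)
  also have "\<dots> \<longleftrightarrow> grid_of s" (is "?L \<longleftrightarrow> ?R")
  proof
    assume L: ?L
    note r1 = conjunct2[OF L]
    note r2 = conjunct2[OF r1]
    note r3 = conjunct2[OF r2]
    note r4 = conjunct2[OF r3]
    note r5 = conjunct2[OF r4]
    note r6 = conjunct2[OF r5]
    note r7 = conjunct2[OF r6]
    note r8 = conjunct2[OF r7]
    note r9 = conjunct2[OF r8]
    note r10 = conjunct2[OF r9]
    show ?R
      by (intro arith_grid.intro[OF valid_grid[OF assms]] arith_grid_axioms.intro)
        ((rule conjunct1[OF L, rule_format]; assumption),
         (rule conjunct1[OF r1, rule_format]; assumption),
         (rule conjunct1[OF r2, rule_format]; assumption),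
         (rule conjunct1[OF r3, rule_format]; assumption),
         (rule conjunct1[OF r4, rule_format]; assumption),
         (rule conjunct1[OF r5, rule_format]; assumption),
         (rule conjunct1[OF r6, rule_format]; assumption),
         (rule conjunct1[OF r7, rule_format]; assumption),
         (rule conjunct1[OF r8, rule_format]; assumption),
         (rule conjunct1[OF r9, rule_format]; assumption),
         (rule r10[rule_format]; assumption?; blast))
  next
    assume ?R
    then interpret arith_grid "s 3" "s 4" "s 5" "s 6" "s 7" "s 8" .
    show ?L
      by (intro conjI ballI allI impI)
        ((rule pairing, assumption+), (rule row_inj; assumption), (rule col_inj; assumption),
         (rule not_clop; assumption), (rule col_ex; assumption), (rule Z_in), (rule S_ex; assumption),
         (rule S_fun; assumption), (rule S_inj; assumption), (rule S_Z; assumption),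
         (rule induct; assumption))
  qed
  finally show ?thesis .
qed

text \<open>Indexed by the symbols of \<open>sig_N2\<close>. The guards make an atom false on
  arguments of the wrong sort, as in \<open>N2_rel\<close>; \<open>addF\<close> and
  \<open>multF\<close> say nothing useful outside the numbers.\<close>

definition psiN2 :: "nat \<Rightarrow> form" where
  "psiN2 r = [compF 0 5 9, clopF 0 4 9, Conj (compF 0 5 9) (Conj (clopF 1 4 9) (subF 0 1)),
     foldr Conj [compF 0 5 9, compF 1 5 9, compF 2 5 9] (addF 0 1 2),
     foldr Conj [compF 0 5 9, compF 1 5 9, compF 2 5 9] (multF 0 1 2)] ! r"

lemmas lattice_defs = emptyF_def disjF_def unionF_def clopF_def compF_def AllC_def ExC_def AllP_def
  sameF_def relF_def

lemma fv_macros [simp]: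
  "x < b \<Longrightarrow> fv (emptyF x b) = {x}"
  "x < b \<Longrightarrow> y < b \<Longrightarrow> fv (disjF x y b) = {x, y}"
  "x < b \<Longrightarrow> y < b \<Longrightarrow> z < b \<Longrightarrow> fv (unionF x y z b) = {x, y, z}"
  "x < b \<Longrightarrow> y < b \<Longrightarrow> fv (clopF x y b) = {x, y}"
  "x < b \<Longrightarrow> y < b \<Longrightarrow> fv (compF x y b) = {x, y}"
  "x < b \<Longrightarrow> y < b \<Longrightarrow> z < b \<Longrightarrow> fv (sameF x y z b) = {x, y, z}"
  by (auto simp: lattice_defs)

lemma fv_relF [simp]:
  "9 \<le> b \<Longrightarrow> x < b \<Longrightarrow> y < b \<Longrightarrow> z < b \<Longrightarrow> fv (relF x y z b) = {x, y, z, 3, 4, 6}"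
  by (simp add: relF_def ExC_def) auto

lemma fv_quantifiers [simp]:
  "x < b \<Longrightarrow> g < b \<Longrightarrow> fv (AllC x g b p) = insert g (fv p) - {x}"
  "x < b \<Longrightarrow> g < b \<Longrightarrow> fv (ExC x g b p) = insert g (fv p) - {x}"
  "x < b \<Longrightarrow> g < b \<Longrightarrow> fv (AllP x g b p) = insert g (fv p) - {x}"
  by (auto simp: AllC_def ExC_def AllP_def)

lemma fv_addF: "fv (addF 0 1 2) = {0, 1, 2, 3, 4, 5, 6, 7, 8}"
  and fv_addF': "fv (addF 13 0 14) = {13, 0, 14, 3, 4, 5, 6, 7, 8}"
  by (simp_all add: addF_def insert_Diff_if Un_Diff insert_commute)

lemma fv_multF: "fv (multF 0 1 2) = {0, 1, 2, 3, 4, 5, 6, 7, 8}"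
  by (simp add: multF_def fv_addF' insert_Diff_if Un_Diff insert_commute)

lemma sig_sub_0 [simp]: "sig_sub 0 = Some 2"
  by (simp add: sig_sub_def)

lemma wf_macros [simp]:
  "wf_form sig_sub (emptyF x b)" "wf_form sig_sub (disjF x y b)" "wf_form sig_sub (unionF x y z b)"
  "wf_form sig_sub (clopF x g b)" "wf_form sig_sub (compF x g b)" "wf_form sig_sub (sameF x y z b)"
  "wf_form sig_sub (relF x y z b)"
  "wf_form sig_sub (AllC x g b p) \<longleftrightarrow> wf_form sig_sub p"
  "wf_form sig_sub (ExC x g b p) \<longleftrightarrow> wf_form sig_sub p"
  "wf_form sig_sub (AllP x g b p) \<longleftrightarrow> wf_form sig_sub p"
  by (simp_all add: lattice_defs)

text \<open>The margin \<open>6\<close> covers the deepest nesting of auxiliary variables, which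
  occurs in \<open>relF\<close>.\<close>

lemma bv_macros [simp]:
  assumes "m \<le> b" "b + 6 < k"
  shows "bv (clopF x g b) \<subseteq> {m..<k}" "bv (compF x g b) \<subseteq> {m..<k}" "bv (sameF x y z b) \<subseteq> {m..<k}"
    "bv (relF x y z b) \<subseteq> {m..<k}"
    "bv (AllC x g b p) \<subseteq> {m..<k} \<longleftrightarrow> x \<in> {m..<k} \<and> bv p \<subseteq> {m..<k}"
    "bv (ExC x g b p) \<subseteq> {m..<k} \<longleftrightarrow> x \<in> {m..<k} \<and> bv p \<subseteq> {m..<k}"
    "bv (AllP x g b p) \<subseteq> {m..<k} \<longleftrightarrow> x \<in> {m..<k} \<and> bv p \<subseteq> {m..<k}"
  using assms by (auto simp: lattice_defs)

text \<open>The arities are at most \<open>3\<close>, so the parameters can start at variable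
  \<open>3\<close>; the shift \<open>100\<close> exceeds every variable of the templates. Numbers
  and sets have unique names, hence plain \<open>Eq 0 1\<close>.\<close>

interpretation N2_in_lattice: interpretation_scheme "[1, 1, 2, 3, 3]" sig_sub psiN2
    "FOr (compF 0 5 9) (clopF 0 4 9)" "Eq 0 1" goodF "[3, 4, 5, 6, 7, 8]" 100
proof
  show "template sig_sub (set [3, 4, 5, 6, 7, 8]) 100 ([1, 1, 2, 3, 3] ! r) (psiN2 r)"
    if "r < length [1, 1, 2, 3, 3]" for r
  proof -
    have "r = 0 \<or> r = 1 \<or> r = 2 \<or> r = 3 \<or> r = 4"
      using that by auto
    moreover have "{..<3} = {0, 1, 2::nat}" "{..<2} = {0, 1::nat}" "{..<1} = {0::nat}"
      by auto
    moreover have "wf_form sig_sub (addF 0 1 2)" "wf_form sig_sub (addF 13 0 14)"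
      "bv (addF 0 1 2) \<subseteq> {3..<100}" "bv (addF 13 0 14) \<subseteq> {3..<100}"
      by (simp_all add: addF_def)
    moreover from this have "wf_form sig_sub (multF 0 1 2)" "bv (multF 0 1 2) \<subseteq> {3..<100}"
      by (simp_all add: multF_def)
    ultimately show ?thesis
      by (elim disjE) (simp_all add: template_def psiN2_def fv_addF[simplified] fv_multF[simplified])
  qed
  have "{..<2} = {0, 1::nat}" "{..<1} = {0::nat}"
    by auto
  then show "template sig_sub (set [3, 4, 5, 6, 7, 8]) 100 2 (Eq 0 1)"
    "template sig_sub (set [3, 4, 5, 6, 7, 8]) 100 1 (FOr (compF 0 5 9) (clopF 0 4 9))"
    by (simp_all add: template_def)
  show "wf_form sig_sub goodF" "fv goodF \<subseteq> set [3, 4, 5, 6, 7, 8]"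
    by (simp_all add: goodF_def insert_Diff_if)
  show "[1, 1, 2, 3, 3] \<noteq> ([] :: nat list)" "[1, 1, 2, 3, 3] ! 0 \<noteq> (0 :: nat)" "sig_sub 0 \<noteq> Some 0"
    by simp_all
qed

lemma valid_update:
  assumes e: "range e \<subseteq> open_lattice_dom" and bs: "set bs \<subseteq> open_lattice_dom"
  shows "valid (update e bs)"
proof -
  have "update e bs v \<in> open_lattice_dom" for v
  proof (cases "v < length bs")
    case True
    then have "bs ! v \<in> set bs"
      by simp
    with bs show ?thesis
      using True by (simp only: update_def subset_iff if_True)
  next
    case False
    have "e v \<in> open_lattice_dom"
      using e by blast
    with False show ?thesis
      by (simp only: update_def if_False)
  qed
  then show ?thesis
    by (simp add: valid_def open_lattice_dom_def)
qed

lemma update_simps [simp]: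
  "update e [x] 0 = x"
  "update e [x, y] 0 = x" "update e [x, y] (Suc 0) = y"
  "update e [x, y, z] 0 = x" "update e [x, y, z] (Suc 0) = y" "update e [x, y, z] 2 = z"
  "length bs \<le> 3 \<Longrightarrow> 3 \<le> v \<Longrightarrow> update e bs v = e v"
  by (simp_all add: update_def)

lemma N2_rel_iff:
  "N2_rel 3 [x, y, z] \<longleftrightarrow> (\<exists>a b. x = Inl a \<and> y = Inl b \<and> z = Inl (a + b))"
  "N2_rel 4 [x, y, z] \<longleftrightarrow> (\<exists>a b. x = Inl a \<and> y = Inl b \<and> z = Inl (a * b))"
  "N2_rel 2 [x, y] \<longleftrightarrow> (\<exists>n S. x = Inl n \<and> y = Inr S \<and> n \<in> S)"
  "N2_rel 1 [x] \<longleftrightarrow> (\<exists>S. x = Inr S)"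
  by (simp_all add: numeral_2_eq_2 numeral_3_eq_3 eval_nat_numeral)

context
  fixes e :: "nat \<Rightarrow> (real ^ 'n) set"
  assumes e: "range e \<subseteq> open_lattice_dom" and good: "grid_of e"
begin

interpretation arith_grid "e 3" "e 4" "e 5" "e 6" "e 7" "e 8"
  by (rule good)

lemma decode_interprets:
  "N2_in_lattice.interprets UNIV N2_rel open_lattice_dom subset_rel e decode"
proof -
  have grid: "grid_of (update e bs)" if "length bs \<le> 3" for bs
    using good that by simp
  have op: "clop (e 4) b \<or> b \<in> components (e 5) \<Longrightarrow> b \<in> open_lattice_dom" for b
    using open_component[of b "e 5"] open_params by (auto simp: open_lattice_dom_def clop_def)
  have dl: "lsat (update e [b]) (FOr (compF 0 5 9) (clopF 0 4 9)) \<longleftrightarrow> b \<in> range num \<or> b \<in> range set_of"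
    if "b \<in> open_lattice_dom" for b
    using valid_update[OF e, of "[b]"] that by (simp add: range_num clop_V_iff)
  define dom where "dom = range num \<union> range set_of"
  have dom: "{b \<in> open_lattice_dom. lsat (update e [b]) (FOr (compF 0 5 9) (clopF 0 4 9))} = dom"
    using dl op by (auto simp: dom_def range_num clop_V_iff)
  have sub: "set_of T \<in> open_lattice_dom" "num n \<in> open_lattice_dom" for T n
    using op clop_set_of num_in by auto
  have dom_open: "b \<in> open_lattice_dom" if "b \<in> dom" for b
    using that sub by (auto simp: dom_def)
  have image: "decode ` dom = UNIV"
  proof -
    have "x \<in> decode ` dom" for x
      by (cases x) (auto simp: dom_def image_Un image_image)
    then show ?thesis by auto
  qed
  have inj: "lsat (update e [b, c]) (Eq 0 1) \<longleftrightarrow> decode b = decode c" if "b \<in> dom" "c \<in> dom" for b c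
    using that by (auto simp: dom_def)
  have rel: "lsat (update e bs) (psiN2 r) \<longleftrightarrow> N2_rel r (map decode bs)"
    if r: "r < length [1, 1, 2, 3, 3::nat]" and len: "length bs = [1, 1, 2, 3, 3] ! r" and bs: "set bs \<subseteq> dom" for r bs
  proof -
    have v: "valid (update e bs)"
      using bs dom_open by (intro valid_update[OF e]) auto
    have comp: "num n \<in> components (e 5)" "\<not> clop (e 4) (num n)" "clop (e 4) (set_of T)"
      "set_of T \<notin> components (e 5)" for n T
      using num_in not_clop clop_set_of by auto
    have mem: "num n \<subseteq> set_of T \<longleftrightarrow> n \<in> T" for n T
      by (simp add: subset_set_of[OF num_in] inj_image_mem_iff[OF inj_num])
    have "r = 0 \<or> r = 1 \<or> r = 2 \<or> r = 3 \<or> r = 4"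
      using r by auto
    then show ?thesis
    proof (elim disjE)
      assume "r = 0"
      then obtain x where "bs = [x]"
        using len by (auto simp: length_Suc_conv)
      then show ?thesis
        using v bs \<open>r = 0\<close> by (auto simp: psiN2_def dom_def comp)
    next
      assume "r = 1"
      then obtain x where "bs = [x]"
        using len by (auto simp: length_Suc_conv)
      then show ?thesis
        using v bs \<open>r = 1\<close> by (auto simp: psiN2_def dom_def comp)
    next
      assume "r = 2"
      then obtain x y where "bs = [x, y]"
        using len by (auto simp: length_Suc_conv numeral_2_eq_2)
      then show ?thesis
        using v bs \<open>r = 2\<close> by (auto simp: psiN2_def dom_def comp mem N2_rel_iff simp del: N2_rel.simps del: subsetI)
    next
      assume "r = 3"
      then obtain x y z where "bs = [x, y, z]"
        using len by (auto simp: length_Suc_conv numeral_3_eq_3)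
      then show ?thesis
        using v bs \<open>r = 3\<close> grid[of bs] by (auto simp: psiN2_def dom_def comp N2_rel_iff add_num)
    next
      assume "r = 4"
      then obtain x y z where "bs = [x, y, z]"
        using len by (auto simp: length_Suc_conv numeral_3_eq_3)
      then show ?thesis
        using v bs \<open>r = 4\<close> grid[of bs] by (auto simp: psiN2_def dom_def comp N2_rel_iff mult_num)
    qed
  qed
  show ?thesis
    unfolding N2_in_lattice.interprets_def dom Let_def using image inj rel by blast
qed

end

theorem FO_N2_reducible:
  assumes "CARD('n) \<ge> 2"
  shows "m_reducible (FO sig_N2 (UNIV :: (nat + nat set) set) N2_rel)
    (FO sig_sub (open_lattice_dom :: (real ^ 'n) set set) subset_rel)"
proof -
  have valid: "valid e" if "range e \<subseteq> open_lattice_dom" for e :: "nat \<Rightarrow> (real ^ 'n) set"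
    using that by (auto simp: valid_def open_lattice_dom_def)
  have "sig_N2 r = N2_in_lattice.sigA r" for r
    unfolding N2_in_lattice.sigA_def by (auto simp: sig_N2_def numeral_eq_Suc less_Suc_eq)
  then have "sig_N2 = N2_in_lattice.sigA"
    by auto
  moreover have "m_reducible (FO N2_in_lattice.sigA (UNIV :: (nat + nat set) set) N2_rel)
    (FO sig_sub (open_lattice_dom :: (real ^ 'n) set set) subset_rel)"
  proof (rule N2_in_lattice.m_reducible)
    obtain H V D G S Z :: "(real ^ 'n) set" where g: "arith_grid H V D G S Z"
      using exists_arith_grid[OF assms] by blast
    \<comment> \<open>The first three entries fill the placeholder slots
      \<open>0, 1, 2\<close>.\<close>
    define e where "e = update (\<lambda>_. {}) [{}, {}, {}, H, V, D, G, S, Z]"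
    have "open H" "open V" "open D" "open G" "open S" "open Z"
      using g unfolding arith_grid_def grid_def by auto
    then have "range e \<subseteq> open_lattice_dom"
      by (auto simp: e_def update_def open_lattice_dom_def nth_Cons split: nat.splits)
    moreover have "grid_of e"
      using g by (simp add: e_def update_def)
    ultimately show "\<exists>e :: nat \<Rightarrow> (real ^ 'n) set. range e \<subseteq> open_lattice_dom \<and> lsat e goodF"
      using sat_goodF valid by blast
  next
    fix e :: "nat \<Rightarrow> (real ^ 'n) set"
    assume e: "range e \<subseteq> open_lattice_dom" "lsat e goodF"
    then have "grid_of e"
      using sat_goodF valid by blast
    then show "\<exists>f. N2_in_lattice.interprets (UNIV :: (nat + nat set) set) N2_rel open_lattice_dom subset_rel e f"
      using decode_interprets[OF e(1)] by blast
  qed simp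
  ultimately show ?thesis
    by simp
qed

section \<open>Coding open sets by sets of numbers\<close>

text \<open>A pairing expressible by two sums and one square, without the halving of Cantor's. It is
  not surjective, which leaves a number free to mark the end of a list.\<close>

definition pr :: "nat \<Rightarrow> nat \<Rightarrow> nat" where
  "pr m n = (m + n) * (m + n) + m"

text \<open>The value lies between the square of \<open>m + n\<close> and the next square, so it
  determines the sum and then \<open>m\<close>.\<close>

lemma pr_inject [simp]: "pr m n = pr m' n' \<longleftrightarrow> m = m' \<and> n = n'"
proof
  assume eq: "pr m n = pr m' n'"
  have less: "pr m n < pr m' n'" if "m + n < m' + n'" for m n m' n'
  proof -
    have "pr m n < Suc (m + n) * Suc (m + n)"
      by (simp add: pr_def)
    also have "\<dots> \<le> (m' + n') * (m' + n')"
      using that by (intro mult_le_mono) auto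
    finally show ?thesis
      by (simp add: pr_def)
  qed
  have "m + n = m' + n'"
    using less[of m n m' n'] less[of m' n' m n] eq by linarith
  then show "m = m' \<and> n = n'"
    using eq by (simp add: pr_def)
qed simp

lemma le_pr: "m \<le> pr m n" "n \<le> pr m n"
  by (simp_all add: pr_def) (metis le_add2 le_add_same_cancel1 le_square le_trans trans_le_add1)

text \<open>Sums \<open>0\<close> and \<open>1\<close> yield the values \<open>0, 1, 2\<close>,
  larger sums at least \<open>4\<close>. Thus \<open>3\<close> can stand for the empty list.\<close>

lemma pr_neq_3: "pr m n \<noteq> 3"
proof
  assume eq: "pr m n = 3"
  have "m + n < 2"
  proof (rule ccontr)
    assume "\<not> m + n < 2"
    then have "2 * 2 \<le> (m + n) * (m + n)"
      by (intro mult_le_mono) auto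
    then show False
      using eq by (simp add: pr_def)
  qed
  then have "m + n = 0 \<or> m + n = 1"
    by auto
  then show False
    using eq by (auto simp: pr_def)
qed

text \<open>Iterated second components, as the least set containing \<open>k\<close> and closed
  under them. The set quantifier replaces a first-order coding of finite sequences.\<close>

definition tail :: "nat \<Rightarrow> nat \<Rightarrow> bool" where
  "tail k t \<longleftrightarrow> (\<forall>R. k \<in> R \<longrightarrow> (\<forall>a u. pr a u \<in> R \<longrightarrow> u \<in> R) \<longrightarrow> t \<in> R)"

definition elem :: "nat \<Rightarrow> nat \<Rightarrow> bool" where
  "elem k c \<longleftrightarrow> (\<exists>t. tail k (pr c t))"

lemma tail_refl: "tail k k"
  by (simp add: tail_def)

lemma tail_step: "tail k (pr a u) \<Longrightarrow> tail k u"
  unfolding tail_def by blast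

lemma tail_le: "tail k t \<Longrightarrow> t \<le> k"
proof -
  assume "tail k t"
  moreover have "u \<in> {..k}" if "pr a u \<in> {..k}" for a u
    using that le_trans[OF le_pr(2)] by simp
  ultimately have "t \<in> {..k}"
    unfolding tail_def by blast
  then show "t \<le> k"
    by simp
qed

lemma tail_pr: "tail (pr a t) u \<longleftrightarrow> u = pr a t \<or> tail t u"
proof
  assume "tail (pr a t) u"
  moreover have "w \<in> insert (pr a t) {u. tail t u}"
    if "pr b w \<in> insert (pr a t) {u. tail t u}" for b w
    using that tail_refl tail_step by auto
  ultimately have "u \<in> insert (pr a t) {u. tail t u}"
    unfolding tail_def[of "pr a t"] by blast
  then show "u = pr a t \<or> tail t u"
    by simp
next
  have "tail (pr a t) t"
    by (rule tail_step[OF tail_refl])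
  then have "tail (pr a t) u" if "tail t u"
    using that unfolding tail_def by blast
  then show "u = pr a t \<or> tail t u \<Longrightarrow> tail (pr a t) u"
    using tail_refl by blast
qed

lemma tail_3: "tail 3 u \<longleftrightarrow> u = 3"
proof
  have "w \<in> {3}" if "pr b w \<in> {3}" for b w
    using that pr_neq_3 by simp
  then show "tail 3 u \<Longrightarrow> u = 3"
    unfolding tail_def by (metis singletonD singletonI)
qed (simp add: tail_refl)

primrec lcode :: "nat list \<Rightarrow> nat" where
  "lcode [] = 3"
| "lcode (c # cs) = pr c (lcode cs)"

lemma elem_lcode: "elem (lcode cs) c \<longleftrightarrow> c \<in> set cs"
  unfolding elem_def by (induction cs) (auto simp: tail_3 tail_pr pr_neq_3)

text \<open>Required for every number, not only for values of \<open>lcode\<close>: a code of an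
  open set may contain any numbers, and only finite intersections of subbasic sets are sure to be
  open.\<close>

lemma finite_elem: "finite {c. elem k c}"
proof (rule finite_subset)
  show "{c. elem k c} \<subseteq> {..k}"
    using tail_le le_pr(1) le_trans by (fastforce simp: elem_def)
qed simp

text \<open>The pair \<open>pr u w\<close> stands for the fraction \<open>u / w\<close>; \<open>lt\<close> compares fractions, with the
  convention that \<open>u / 0\<close> is infinite.\<close>

definition lt :: "nat \<Rightarrow> nat \<Rightarrow> bool" where
  "lt a b \<longleftrightarrow> (\<exists>u w u' w'. a = pr u w \<and> b = pr u' w' \<and> u * w' < u' * w)"

lemma lt_pr [simp]: "lt (pr u w) (pr u' w') \<longleftrightarrow> u * w' < u' * w"
  by (auto simp: lt_def)

text \<open>The condition amounts to \<open>u / w < r\<close> and fails at \<open>w = 0\<close>, so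
  infinite fractions are never members.\<close>

definition cut :: "real \<Rightarrow> nat set" where
  "cut r = {pr u w | u w. real u < r * real w}"

lemma pr_in_cut [simp]: "pr u w \<in> cut r \<longleftrightarrow> real u < r * real w"
  by (auto simp: cut_def)

text \<open>The equivalence states closure downwards and the absence of a largest member at once,
  and it forces members to be finite fractions. In the last clause \<open>lt a b\<close> makes
  \<open>a\<close> a finite fraction; without it any number that is not a pair would be a
  witness.\<close>

definition is_cut :: "nat set \<Rightarrow> bool" where
  "is_cut A \<longleftrightarrow> (\<forall>a. a \<in> A \<longleftrightarrow> (\<exists>b. lt a b \<and> b \<in> A)) \<and> (\<exists>b. b \<in> A) \<and> (\<exists>a b. lt a b \<and> a \<notin> A)"

lemma frac_dense:
  fixes p q :: real
  assumes "0 \<le> p" "p < q"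
  shows "\<exists>(u :: nat) (w :: nat). (0 :: nat) < w \<and> p * w < u \<and> u < q * w"
proof -
  \<comment> \<open>Scaled by this \<open>w\<close>, the interval is longer than \<open>1\<close>
    and so contains a natural number.\<close>
  obtain w :: nat where w: "1 / (q - p) < w"
    using reals_Archimedean2 by blast
  have "0 < 1 / (q - p)"
    using assms by simp
  then have "real w > 0"
    using w by linarith
  have *: "q * w - p * w > 1"
    using w assms by (simp add: field_simps)
  let ?u = "nat \<lfloor>p * w\<rfloor> + 1"
  have "p * w < ?u" "?u \<le> p * w + 1"
    using assms \<open>real w > 0\<close> by (simp_all add: of_nat_nat) linarith
  then show ?thesis
    using * \<open>real w > 0\<close> by (intro exI[of _ ?u] exI[of _ w] conjI) (simp, linarith, linarith)
qed

lemma is_cut_cut: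
  assumes "r > 0"
  shows "is_cut (cut r)"
  unfolding is_cut_def
proof (intro conjI allI iffI)
  fix a
  assume "a \<in> cut r"
  then obtain u w where a: "a = pr u w" "real u < r * real w"
    by (auto simp: cut_def)
  then have w: "real w > 0"
    by (cases "w = 0") auto
  then have "real u / real w < r"
    using a by (simp add: field_simps)
  then obtain u' w' :: nat where "w' > 0" "real u / real w * w' < u'" "u' < r * w'"
    using frac_dense[OF divide_nonneg_nonneg[OF of_nat_0_le_iff of_nat_0_le_iff]] by blast
  then have "real (u * w') < real (u' * w)" "u' < r * w'"
    using w by (simp_all add: field_simps)
  then have "lt a (pr u' w') \<and> pr u' w' \<in> cut r"
    unfolding a by (simp only: lt_pr pr_in_cut of_nat_less_iff)
  then show "\<exists>b. lt a b \<and> b \<in> cut r"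
    by blast
next
  fix a
  assume "\<exists>b. lt a b \<and> b \<in> cut r"
  then obtain u w u' w' where a: "a = pr u w" "u * w' < u' * w" "real u' < r * real w'"
    by (auto simp: lt_def)
  have "w' > 0"
    using a by (cases "w' = 0") auto
  have "w > 0"
    using a by (cases "w = 0") auto
  have "real u * w' < real u' * w"
    using a(2) by (metis of_nat_less_iff of_nat_mult)
  also have "\<dots> < r * real w' * w"
    using a \<open>w > 0\<close> by simp
  finally have "real w' * real u < real w' * (r * real w)"
    by (simp add: mult_ac)
  then show "a \<in> cut r"
    using a \<open>w' > 0\<close> by simp
next
  show "\<exists>b. b \<in> cut r"
    using assms by (intro exI[of _ "pr 0 1"]) simp
next
  obtain m :: nat where "r < m"
    using reals_Archimedean2 by blast
  then have "lt (pr m 1) (pr (Suc m) 1) \<and> pr m 1 \<notin> cut r"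
    by simp
  then show "\<exists>a b. lt a b \<and> a \<notin> cut r"
    by blast
qed

lemma is_cut_imp_cut:
  assumes "is_cut A"
  shows "\<exists>r>0. A = cut r"
proof -
  have A: "a \<in> A \<Longrightarrow> \<exists>b. lt a b \<and> b \<in> A" "lt a b \<Longrightarrow> b \<in> A \<Longrightarrow> a \<in> A" for a b
    using assms unfolding is_cut_def by blast+
  have pos: "w > 0" if a: "pr u w \<in> A" for u w
  proof -
    obtain b where "lt (pr u w) b"
      using A(1)[OF a] by blast
    then show ?thesis
      by (auto simp: lt_def intro: gr0I)
  qed
  have pair: "\<exists>u w. a = pr u w" if "a \<in> A" for a
    using A(1)[OF that] by (auto simp: lt_def)
  have less: "real u / real w < real u' / real w' \<longleftrightarrow> lt (pr u w) (pr u' w')" if "w > 0" "w' > 0"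
    for u w u' w'
  proof -
    have "real u / real w < real u' / real w' \<longleftrightarrow> real (u * w') < real (u' * w)"
      using that by (simp add: field_simps)
    then show ?thesis
      by (simp only: of_nat_less_iff lt_pr)
  qed
  define X where "X = {real u / real w | u w. pr u w \<in> A}"
  have "X \<noteq> {}"
  proof -
    obtain a where "a \<in> A"
      using assms unfolding is_cut_def by blast
    then obtain u w where "pr u w \<in> A"
      using pair by blast
    then show ?thesis
      unfolding X_def by blast
  qed
  \<comment> \<open>The last clause of \<open>is_cut\<close> yields a finite fraction outside
    \<open>A\<close>, which bounds the values of the members from above.\<close>
  obtain a b where "a \<notin> A" "lt a b"
    using assms unfolding is_cut_def by blast
  then obtain u0 w0 u1 w1 where 0: "pr u0 w0 \<notin> A" "u0 * w1 < u1 * w0"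
    by (auto simp: lt_def)
  then have "w0 > 0"
    by (auto intro: gr0I)
  have "x \<le> real u0 / real w0" if X: "x \<in> X" for x
  proof (rule ccontr)
    assume *: "\<not> x \<le> real u0 / real w0"
    obtain u w where x: "x = real u / real w" "pr u w \<in> A"
      using X by (auto simp: X_def)
    have "real u0 / real w0 < real u / real w"
      using * x(1) by linarith
    then have "lt (pr u0 w0) (pr u w)"
      by (rule iffD1[OF less[OF \<open>w0 > 0\<close> pos[OF x(2)]]])
    then show False
      using 0(1) A(2) x(2) by blast
  qed
  then have bdd: "bdd_above X"
    by (rule bdd_aboveI)
  define r where "r = Sup X"
  have iff: "pr u w \<in> A \<longleftrightarrow> real u < r * real w" for u w
  proof
    assume a: "pr u w \<in> A"
    then obtain b where b: "lt (pr u w) b" "b \<in> A"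
      using A(1) by blast
    then obtain u' w' where b': "b = pr u' w'"
      using pair by blast
    have "real u / real w < real u' / real w'"
      using b unfolding b' by (intro iffD2[OF less] pos[OF a] pos) auto
    also have "\<dots> \<le> r"
      unfolding r_def using b b' by (intro cSup_upper bdd) (auto simp: X_def)
    finally show "real u < r * real w"
      using pos[OF a] by (simp add: field_simps)
  next
    assume a: "real u < r * real w"
    then have "w > 0"
      by (auto intro: gr0I)
    then have "real u / real w < r"
      using a by (simp add: field_simps)
    then obtain x where x: "x \<in> X" "real u / real w < x"
      unfolding r_def using less_cSup_iff[OF \<open>X \<noteq> {}\<close> bdd] by blast
    then obtain u' w' where "x = real u' / real w'" "pr u' w' \<in> A"
      by (auto simp: X_def)
    then have "lt (pr u w) (pr u' w')"
      using x(2) by (intro iffD1[OF less[OF \<open>w > 0\<close> pos]]) auto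
    then show "pr u w \<in> A"
      using A(2) \<open>pr u' w' \<in> A\<close> by blast
  qed
  obtain a where "a \<in> A"
    using assms unfolding is_cut_def by blast
  then obtain u w where "pr u w \<in> A"
    using pair by blast
  then have "0 \<le> real u" "real u < r * real w"
    using iff by auto
  then have "0 < r * real w"
    by linarith
  then have "r > 0"
    using pos[OF \<open>pr u w \<in> A\<close>] by (simp add: zero_less_mult_iff)
  moreover have "A = cut r"
  proof (intro set_eqI iffI)
    fix a
    assume "a \<in> A"
    then show "a \<in> cut r"
      using pair[of a] iff unfolding cut_def by blast
  qed (auto simp: cut_def iff)
  ultimately show ?thesis
    by blast
qed

section \<open>Codes of points and open sets\<close>

locale coding =
  fixes m :: nat and idx :: "nat \<Rightarrow> 'n::finite"
  assumes idx: "bij_betw idx {..m} UNIV"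
begin

definition point_code :: "real ^ 'n \<Rightarrow> nat set" where
  "point_code x = {pr i a | i a. i \<le> m \<and> a \<in> cut (exp (x $ idx i))}"

definition is_point :: "nat set \<Rightarrow> bool" where
  "is_point P \<longleftrightarrow> (\<forall>i\<le>m. is_cut {a. pr i a \<in> P})"

text \<open>\<open>c\<close> holds a coordinate index and two fractions strictly enclosing
  \<open>exp\<close> of that coordinate. For the upper bound a smaller fraction must lie outside the
  cut; asking only that \<open>b\<close> is outside would give a condition that is not open.\<close>

definition in_subbase :: "nat \<Rightarrow> nat set \<Rightarrow> bool" where
  "in_subbase c P \<longleftrightarrow> (\<exists>i a b. i \<le> m \<and> c = pr i (pr a b) \<and> pr i a \<in> P \<and> (\<exists>b'. lt b' b \<and> pr i b' \<notin> P))"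

definition in_code :: "nat set \<Rightarrow> nat set \<Rightarrow> bool" where
  "in_code P S \<longleftrightarrow> (\<exists>k\<in>S. \<forall>c. elem k c \<longrightarrow> in_subbase c P)"

definition open_of :: "nat set \<Rightarrow> (real ^ 'n) set" where
  "open_of S = {x. in_code (point_code x) S}"

lemma section_point_code: "i \<le> m \<Longrightarrow> {a. pr i a \<in> point_code x} = cut (exp (x $ idx i))"
  by (auto simp: point_code_def)

lemma is_point_point_code: "is_point (point_code x)"
  by (auto simp: is_point_def section_point_code is_cut_cut)

text \<open>\<open>is_point\<close> constrains pairs with index at most \<open>m\<close> only, so
  agreement with a true point is limited to these; by \<open>in_subbase_cong\<close> nothing more is
  looked at.\<close>

lemma is_point_imp:
  assumes "is_point P"
  shows "\<exists>x. \<forall>i\<le>m. \<forall>a. pr i a \<in> P \<longleftrightarrow> pr i a \<in> point_code x"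
proof -
  have "\<forall>i. \<exists>r. i \<le> m \<longrightarrow> r > 0 \<and> {a. pr i a \<in> P} = cut r"
    using assms is_cut_imp_cut unfolding is_point_def by blast
  then obtain r where r: "\<And>i. i \<le> m \<Longrightarrow> r i > 0 \<and> {a. pr i a \<in> P} = cut (r i)"
    by metis
  define x :: "real ^ 'n" where "x = (\<chi> j. ln (r (inv_into {..m} idx j)))"
  have "{a. pr i a \<in> P} = {a. pr i a \<in> point_code x}" if "i \<le> m" for i
  proof -
    have "exp (x $ idx i) = r i"
      using that r[OF that] idx by (simp add: x_def bij_betw_def inv_into_f_f)
    then show ?thesis
      using r[OF that] section_point_code[OF that, of x] by simp
  qed
  then show ?thesis
    unfolding set_eq_iff mem_Collect_eq by (intro exI[of _ x] allI impI) blast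
qed

lemma in_subbase_cong:
  assumes "\<And>i a. i \<le> m \<Longrightarrow> pr i a \<in> P \<longleftrightarrow> pr i a \<in> Q"
  shows "in_subbase c P \<longleftrightarrow> in_subbase c Q"
  unfolding in_subbase_def using assms by (intro ex_cong1 conj_cong refl) auto

text \<open>This is what makes inclusion expressible: the points of the space are replaced by a
  definable class of sets of numbers.\<close>

lemma in_code_incl_iff:
  "(\<forall>P. is_point P \<longrightarrow> in_code P S \<longrightarrow> in_code P T) \<longleftrightarrow> open_of S \<subseteq> open_of T"
proof
  assume L: "open_of S \<subseteq> open_of T"
  show "\<forall>P. is_point P \<longrightarrow> in_code P S \<longrightarrow> in_code P T"
  proof (intro allI impI)
    fix P assume P: "is_point P" "in_code P S"
    obtain x where "\<forall>i\<le>m. \<forall>a. pr i a \<in> P \<longleftrightarrow> pr i a \<in> point_code x"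
      using is_point_imp[OF P(1)] by blast
    then have "in_subbase c P \<longleftrightarrow> in_subbase c (point_code x)" for c
      by (intro in_subbase_cong) blast
    then have "in_code P U \<longleftrightarrow> x \<in> open_of U" for U
      by (simp add: in_code_def open_of_def)
    then show "in_code P T"
      using L P by blast
  qed
qed (auto simp: open_of_def is_point_point_code)

lemma in_subbase_point_code:
  "in_subbase c (point_code x) \<longleftrightarrow> (\<exists>i u w u' w'. i \<le> m \<and> c = pr i (pr (pr u w) (pr u' w')) \<and>
     real u < exp (x $ idx i) * real w \<and> exp (x $ idx i) * real w' < real u')"
proof -
  have mem: "pr i a \<in> point_code x \<longleftrightarrow> a \<in> cut (exp (x $ idx i))" if "i \<le> m" for i a
    using section_point_code[OF that, of x] by blast
  have up: "(\<exists>b'. lt b' b \<and> b' \<notin> cut r) \<longleftrightarrow> (\<exists>u w. b = pr u w \<and> r * real w < real u)" if "r > 0" for b r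
  proof
    assume "\<exists>b'. lt b' b \<and> b' \<notin> cut r"
    then obtain v z u w where b: "b = pr u w" "v * w < u * z" "\<not> real v < r * real z"
      by (auto simp: lt_def)
    have "r * real z * real w \<le> real v * real w"
      using b by (intro mult_right_mono) auto
    also have "\<dots> < real u * real z"
      using b(2) by (metis of_nat_less_iff of_nat_mult)
    finally have "real z * (r * real w) < real z * real u"
      by (simp add: mult_ac)
    then have "r * real w < real u"
      by (simp add: mult_less_cancel_left)
    then show "\<exists>u w. b = pr u w \<and> r * real w < real u"
      using b by blast
  next
    assume "\<exists>u w. b = pr u w \<and> r * real w < real u"
    then obtain u w where b: "b = pr u w" "r * real w < real u"
      by blast
    obtain v z :: nat where v: "z > 0" "r * z < v" "real v * real w < real u * real z"
    \<comment> \<open>For \<open>w = 0\<close> the upper bound is infinite and any natural number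
      above \<open>r\<close> serves; otherwise density gives a fraction between \<open>r\<close> and
      \<open>u / w\<close>.\<close>
    proof (cases "w = 0")
      case True
      obtain v :: nat where "r < v"
        using reals_Archimedean2 by blast
      moreover have "real u > 0"
        using b True by simp
      ultimately show ?thesis
        using that[of 1 v] True by simp
    next
      case False
      then have "r < real u / real w"
        using b by (simp add: field_simps)
      then obtain v z :: nat where "z > 0" "r * z < v" "v < real u / real w * z"
        using frac_dense[OF less_imp_le[OF \<open>r > 0\<close>]] by blast
      then show ?thesis
        using that[of z v] False by (simp add: field_simps)
    qed
    have "v * w < u * z"
      using v(3) by (metis of_nat_less_iff of_nat_mult)
    then have "lt (pr v z) b \<and> pr v z \<notin> cut r"
      using b v by simp
    then show "\<exists>b'. lt b' b \<and> b' \<notin> cut r"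
      by blast
  qed
  have "in_subbase c (point_code x) \<longleftrightarrow> (\<exists>i a b. i \<le> m \<and> c = pr i (pr a b) \<and>
      a \<in> cut (exp (x $ idx i)) \<and> (\<exists>b'. lt b' b \<and> b' \<notin> cut (exp (x $ idx i))))"
    unfolding in_subbase_def using mem by (intro ex_cong1 conj_cong refl) auto
  also have "\<dots> \<longleftrightarrow> (\<exists>i u w u' w'. i \<le> m \<and> c = pr i (pr (pr u w) (pr u' w')) \<and>
     real u < exp (x $ idx i) * real w \<and> exp (x $ idx i) * real w' < real u')"
    unfolding up[OF exp_gt_zero] unfolding cut_def mem_Collect_eq by blast
  finally show ?thesis .
qed

lemma open_subbase: "open {x. in_subbase c (point_code x)}"
proof -
  have "{x. in_subbase c (point_code x)} = (\<Union>(i, u, w, u', w') \<in>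
      {(i, u, w, u', w'). i \<le> m \<and> c = pr i (pr (pr u w) (pr u' w'))}.
      {x. real u < exp (x $ idx i) * real w} \<inter> {x. exp (x $ idx i) * real w' < real u'})"
    unfolding in_subbase_point_code by auto
  also have "open \<dots>"
    by (intro open_UN ballI, clarify, intro open_Int open_Collect_less continuous_intros)
  finally show ?thesis .
qed

lemma open_open_of: "open (open_of S)"
proof -
  have "open_of S = (\<Union>k\<in>S. \<Inter>c\<in>{c. elem k c}. {x. in_subbase c (point_code x)})"
    by (auto simp: open_of_def in_code_def)
  also have "open \<dots>"
    using open_subbase finite_elem by (intro open_UN open_INT ballI) auto
  finally show ?thesis .
qed

text \<open>Fractions are chosen between \<open>exp (t - e)\<close> and \<open>exp t\<close>, and
  between \<open>exp t\<close> and \<open>exp (t + e)\<close>; monotonicity of \<open>exp\<close>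
  carries the bounds back to \<open>t\<close>.\<close>

lemma open_interval_exp:
  fixes t :: real
  assumes "open A" "t \<in> A"
  shows "\<exists>u w u' w' :: nat. real u < exp t * real w \<and> exp t * real w' < real u' \<and>
    (\<forall>s. real u < exp s * real w \<and> exp s * real w' < real u' \<longrightarrow> s \<in> A)"
proof -
  obtain e where e: "e > 0" "\<And>s. \<bar>s - t\<bar> < e \<Longrightarrow> s \<in> A"
    using assms unfolding open_dist dist_real_def by blast
  have exp_less: "exp (t - e) < exp t" "exp t < exp (t + e)"
    using e(1) by simp_all
  obtain u w :: nat where u: "w > 0" "exp (t - e) * w < u" "u < exp t * w"
    using frac_dense[OF exp_ge_zero exp_less(1)] by blast
  obtain u' w' :: nat where u': "w' > 0" "exp t * w' < u'" "u' < exp (t + e) * w'"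
    using frac_dense[OF exp_ge_zero exp_less(2)] by blast
  have "s \<in> A" if s: "real u < exp s * real w" "exp s * real w' < real u'" for s
  proof (rule e(2))
    have "exp (t - e) * w < exp s * w" "exp s * w' < exp (t + e) * w'"
      using s u u' by linarith+
    then have "t - e < s" "s < t + e"
      using u(1) u'(1) by simp_all
    then show "\<bar>s - t\<bar> < e"
      by linarith
  qed
  then show ?thesis
    using u u' by blast
qed

lemma open_of_surj:
  assumes "open U"
  shows "\<exists>S. open_of S = U"
proof -
  \<comment> \<open>The largest possible code, all numbers whose basic set lies inside
    \<open>U\<close>. One inclusion is then immediate, and the other asks for a basic box around
    each point of \<open>U\<close>.\<close>
  define S where "S = {k. \<forall>x. (\<forall>c. elem k c \<longrightarrow> in_subbase c (point_code x)) \<longrightarrow> x \<in> U}"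
  have "x \<in> open_of S" if x: "x \<in> U" for x
  proof -
    have "\<exists>A. (\<forall>j. open (A j) \<and> x $ j \<in> A j) \<and> (\<forall>y. (\<forall>j. y $ j \<in> A j) \<longrightarrow> y \<in> U)"
      using assms x unfolding open_vec_def by blast
    then obtain A where A: "\<And>j. open (A j) \<and> x $ j \<in> A j" "\<And>y. (\<And>j. y $ j \<in> A j) \<Longrightarrow> y \<in> U"
      by blast
    have "\<exists>c. in_subbase c (point_code x) \<and>
        (\<forall>y. in_subbase c (point_code y) \<longrightarrow> y $ idx i \<in> A (idx i))" if "i \<le> m" for i
    proof -
      obtain u w u' w' where u: "real u < exp (x $ idx i) * real w" "exp (x $ idx i) * real w' < real u'"
        "\<And>s. real u < exp s * real w \<Longrightarrow> exp s * real w' < real u' \<Longrightarrow> s \<in> A (idx i)"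
        using open_interval_exp[of "A (idx i)" "x $ idx i"] A(1) by blast
      show ?thesis
        unfolding in_subbase_point_code using u \<open>i \<le> m\<close>
        by (intro exI[of _ "pr i (pr (pr u w) (pr u' w'))"]) auto
    qed
    then obtain c where c: "\<And>i. i \<le> m \<Longrightarrow> in_subbase (c i) (point_code x)"
      "\<And>i y. i \<le> m \<Longrightarrow> in_subbase (c i) (point_code y) \<Longrightarrow> y $ idx i \<in> A (idx i)"
      by metis
    define k where "k = lcode (map c [0..<Suc m])"
    have k: "elem k d \<longleftrightarrow> (\<exists>i\<le>m. d = c i)" for d
      unfolding k_def elem_lcode by (auto simp: less_Suc_eq_le simp del: upt_Suc)
    have "y \<in> U" if y: "\<And>d. elem k d \<Longrightarrow> in_subbase d (point_code y)" for y
    proof (rule A(2))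
      fix j
      obtain i where "i \<le> m" "j = idx i"
        using idx by (auto simp: bij_betw_def)
      then show "y $ j \<in> A j"
        using c(2) y k by blast
    qed
    then have "k \<in> S"
      by (simp add: S_def)
    moreover have "in_subbase d (point_code x)" if "elem k d" for d
      using that k c by auto
    ultimately show ?thesis
      by (auto simp: open_of_def in_code_def)
  qed
  moreover have "open_of S \<subseteq> U"
    by (auto simp: open_of_def in_code_def S_def)
  ultimately show ?thesis
    by blast
qed

end

section \<open>The coding as formulas of second-order arithmetic\<close>

abbreviation nsat :: "(nat \<Rightarrow> nat + nat set) \<Rightarrow> form \<Rightarrow> bool" where
  "nsat \<equiv> sat UNIV N2_rel"

definition plusF :: "nat \<Rightarrow> nat \<Rightarrow> nat \<Rightarrow> form" where
  "plusF x y z = Rel 3 [x, y, z]"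

definition timesF :: "nat \<Rightarrow> nat \<Rightarrow> nat \<Rightarrow> form" where
  "timesF x y z = Rel 4 [x, y, z]"

definition memF :: "nat \<Rightarrow> nat \<Rightarrow> form" where
  "memF x y = Rel 2 [x, y]"

definition AllN :: "nat \<Rightarrow> form \<Rightarrow> form" where
  "AllN x p = FAll x (FImp (Rel 0 [x]) p)"

definition ExN :: "nat \<Rightarrow> form \<Rightarrow> form" where
  "ExN x p = Ex x (Conj (Rel 0 [x]) p)"

definition AllS :: "nat \<Rightarrow> form \<Rightarrow> form" where
  "AllS x p = FAll x (FImp (Rel 1 [x]) p)"

definition FIff :: "form \<Rightarrow> form \<Rightarrow> form" where
  "FIff p q = Conj (FImp p q) (FImp q p)"

lemmas N2_basic_defs = plusF_def timesF_def memF_def AllN_def ExN_def AllS_def FIff_def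

lemma sat_N2_basic [simp]:
  "s x = Inl a \<Longrightarrow> s y = Inl b \<Longrightarrow> s z = Inl c \<Longrightarrow> nsat s (plusF x y z) \<longleftrightarrow> c = a + b"
  "s x = Inl a \<Longrightarrow> s y = Inl b \<Longrightarrow> s z = Inl c \<Longrightarrow> nsat s (timesF x y z) \<longleftrightarrow> c = a * b"
  "s x = Inl a \<Longrightarrow> s y = Inr S \<Longrightarrow> nsat s (memF x y) \<longleftrightarrow> a \<in> S"
  "nsat s (AllN x p) \<longleftrightarrow> (\<forall>n. nsat (s(x := Inl n)) p)"
  "nsat s (ExN x p) \<longleftrightarrow> (\<exists>n. nsat (s(x := Inl n)) p)"
  "nsat s (AllS x p) \<longleftrightarrow> (\<forall>R. nsat (s(x := Inr R)) p)"
  "nsat s (FIff p q) \<longleftrightarrow> (nsat s p \<longleftrightarrow> nsat s q)"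
  using N2_rel_iff(4)[unfolded One_nat_def] by (auto simp: N2_basic_defs N2_rel_iff)

lemma fv_N2_basic [simp]:
  "fv (plusF x y z) = {x, y, z}" "fv (timesF x y z) = {x, y, z}" "fv (memF x y) = {x, y}"
  "fv (AllN x p) = fv p - {x}" "fv (ExN x p) = fv p - {x}" "fv (AllS x p) = fv p - {x}"
  "fv (FIff p q) = fv p \<union> fv q"
  by (auto simp: N2_basic_defs)

lemma bv_N2_basic [simp]:
  "bv (plusF x y z) = {}" "bv (timesF x y z) = {}" "bv (memF x y) = {}"
  "bv (AllN x p) = insert x (bv p)" "bv (ExN x p) = insert x (bv p)" "bv (AllS x p) = insert x (bv p)"
  "bv (FIff p q) = bv p \<union> bv q"
  by (auto simp: N2_basic_defs)

lemma wf_N2_basic [simp]: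
  "wf_form sig_N2 (plusF x y z)" "wf_form sig_N2 (timesF x y z)" "wf_form sig_N2 (memF x y)"
  "wf_form sig_N2 (AllN x p) = wf_form sig_N2 p" "wf_form sig_N2 (ExN x p) = wf_form sig_N2 p"
  "wf_form sig_N2 (AllS x p) = wf_form sig_N2 p"
  "wf_form sig_N2 (FIff p q) \<longleftrightarrow> wf_form sig_N2 p \<and> wf_form sig_N2 q"
  by (auto simp: N2_basic_defs sig_N2_def)

text \<open>Each macro binds variables above those of its callers: from \<open>30\<close> in
  \<open>inclF\<close>, \<open>40\<close> in \<open>codeF\<close>, \<open>50\<close> in
  \<open>subbaseF\<close>, \<open>60\<close> in \<open>pointF\<close>, \<open>70\<close> in
  \<open>elemF\<close>, \<open>80\<close> in \<open>ltF\<close> and \<open>90\<close> here. No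
  argument can be captured, and all stay below the shift \<open>100\<close>.\<close>

definition prF :: "nat \<Rightarrow> nat \<Rightarrow> nat \<Rightarrow> form" where
  "prF x y z = ExN 90 (ExN 91 (Conj (plusF x y 90) (Conj (timesF 90 90 91) (plusF 91 x z))))"

lemma sat_prF [simp]:
  "x < 90 \<Longrightarrow> y < 90 \<Longrightarrow> z < 90 \<Longrightarrow> s x = Inl m \<Longrightarrow> s y = Inl n \<Longrightarrow> s z = Inl k \<Longrightarrow>
    nsat s (prF x y z) \<longleftrightarrow> k = pr m n"
  by (simp add: prF_def pr_def)

lemma prF_simps [simp]:
  "x < 90 \<Longrightarrow> y < 90 \<Longrightarrow> z < 90 \<Longrightarrow> fv (prF x y z) = {x, y, z}"
  "bv (prF x y z) = {90, 91}" "wf_form sig_N2 (prF x y z)"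
  by (auto simp: prF_def)

text \<open>The difference of the cross products is nonzero exactly when doubling it changes it,
  which avoids a constant for zero.\<close>

definition ltF :: "nat \<Rightarrow> nat \<Rightarrow> form" where
  "ltF a b = ExN 80 (ExN 81 (ExN 82 (ExN 83 (Conj (prF 80 81 a) (Conj (prF 82 83 b)
     (ExN 84 (ExN 85 (ExN 86 (Conj (timesF 80 83 84) (Conj (timesF 82 81 85)
       (Conj (plusF 84 86 85) (Neg (plusF 86 86 86)))))))))))))"

lemma sat_ltF [simp]:
  "a < 80 \<Longrightarrow> b < 80 \<Longrightarrow> s a = Inl m \<Longrightarrow> s b = Inl n \<Longrightarrow> nsat s (ltF a b) \<longleftrightarrow> lt m n"
proof -
  have "(\<exists>d. q = p + d \<and> 0 < d) \<longleftrightarrow> p < q" for p q :: nat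
    by presburger
  then show "a < 80 \<Longrightarrow> b < 80 \<Longrightarrow> s a = Inl m \<Longrightarrow> s b = Inl n \<Longrightarrow> ?thesis"
    by (simp add: ltF_def lt_def)
qed

lemma ltF_simps [simp]:
  "a < 80 \<Longrightarrow> b < 80 \<Longrightarrow> fv (ltF a b) = {a, b}"
  "bv (ltF a b) = {80, 81, 82, 83, 84, 85, 86, 90, 91}" "wf_form sig_N2 (ltF a b)"
  by (auto simp: ltF_def)

definition elemF :: "nat \<Rightarrow> nat \<Rightarrow> form" where
  "elemF k c = ExN 74 (ExN 75 (Conj (prF c 74 75) (AllS 70 (FImp (memF k 70)
     (FImp (AllN 71 (AllN 72 (AllN 73 (FImp (prF 71 72 73) (FImp (memF 73 70) (memF 72 70))))))
       (memF 75 70))))))"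

lemma sat_elemF [simp]:
  "k < 70 \<Longrightarrow> c < 70 \<Longrightarrow> s k = Inl m \<Longrightarrow> s c = Inl n \<Longrightarrow> nsat s (elemF k c) \<longleftrightarrow> elem m n"
  by (simp add: elemF_def elem_def tail_def)

lemma elemF_simps [simp]:
  "k < 70 \<Longrightarrow> c < 70 \<Longrightarrow> fv (elemF k c) = {k, c}"
  "bv (elemF k c) = {70, 71, 72, 73, 74, 75, 90, 91}" "wf_form sig_N2 (elemF k c)"
  by (auto simp: elemF_def)

definition sectionF :: "nat \<Rightarrow> nat \<Rightarrow> nat \<Rightarrow> form" where
  "sectionF i a P = ExN 64 (Conj (prF i a 64) (memF 64 P))"

lemma sat_sectionF [simp]:
  "i < 64 \<Longrightarrow> a < 64 \<Longrightarrow> P < 64 \<Longrightarrow> s i = Inl j \<Longrightarrow> s a = Inl n \<Longrightarrow> s P = Inr Q \<Longrightarrow>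
    nsat s (sectionF i a P) \<longleftrightarrow> pr j n \<in> Q"
  by (simp add: sectionF_def)

lemma sectionF_simps [simp]:
  "i < 64 \<Longrightarrow> a < 64 \<Longrightarrow> P < 64 \<Longrightarrow> fv (sectionF i a P) = {i, a, P}"
  "bv (sectionF i a P) = {64, 90, 91}" "wf_form sig_N2 (sectionF i a P)"
  by (auto simp: sectionF_def)

text \<open>The variable \<open>3\<close> holds the number \<open>m\<close>, where \<open>Suc m\<close> is the dimension of the space.\<close>

definition indexF :: "nat \<Rightarrow> form" where
  "indexF i = ExN 65 (plusF i 65 3)"

lemma sat_indexF [simp]: "i < 64 \<Longrightarrow> s i = Inl j \<Longrightarrow> s 3 = Inl m \<Longrightarrow> nsat s (indexF i) \<longleftrightarrow> j \<le> m"
  by (simp add: indexF_def le_iff_add)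

lemma indexF_simps [simp]:
  "i < 64 \<Longrightarrow> fv (indexF i) = {i, 3}" "bv (indexF i) = {65}" "wf_form sig_N2 (indexF i)"
  by (auto simp: indexF_def)

definition pointF :: "nat \<Rightarrow> form" where
  "pointF P = AllN 60 (FImp (indexF 60) (Conj
     (AllN 61 (FIff (sectionF 60 61 P) (ExN 62 (Conj (ltF 61 62) (sectionF 60 62 P))))) (Conj
     (ExN 62 (sectionF 60 62 P))
     (ExN 61 (ExN 62 (Conj (ltF 61 62) (Neg (sectionF 60 61 P))))))))"

definition subbaseF :: "nat \<Rightarrow> nat \<Rightarrow> form" where
  "subbaseF c P = ExN 50 (ExN 51 (ExN 52 (Conj (indexF 50) (Conj
     (ExN 53 (Conj (prF 51 52 53) (prF 50 53 c))) (Conj (sectionF 50 51 P)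
     (ExN 54 (Conj (ltF 54 52) (Neg (sectionF 50 54 P)))))))))"

lemma subbaseF_simps [simp]:
  "c < 50 \<Longrightarrow> P < 50 \<Longrightarrow> fv (subbaseF c P) = {c, P, 3}" "wf_form sig_N2 (subbaseF c P)"
  by (simp_all add: subbaseF_def) auto

definition codeF :: "nat \<Rightarrow> nat \<Rightarrow> form" where
  "codeF P S = ExN 40 (Conj (memF 40 S) (AllN 41 (FImp (elemF 40 41) (subbaseF 41 P))))"

definition inclF :: "nat \<Rightarrow> nat \<Rightarrow> form" where
  "inclF S T = AllS 30 (FImp (pointF 30) (FImp (codeF 30 S) (codeF 30 T)))"

lemma inclF_simps [simp]:
  "S < 30 \<Longrightarrow> T < 30 \<Longrightarrow> fv (inclF S T) = {S, T, 3}" "wf_form sig_N2 (inclF S T)"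
  "bv (inclF S T) \<subseteq> {30..<100}"
  by (auto simp: inclF_def pointF_def codeF_def subbaseF_def)

context coding
begin

lemma sat_pointF [simp]:
  "P < 60 \<Longrightarrow> s P = Inr Q \<Longrightarrow> s 3 = Inl m \<Longrightarrow> nsat s (pointF P) \<longleftrightarrow> is_point Q"
  by (simp add: pointF_def is_point_def is_cut_def)

lemma sat_subbaseF [simp]:
  "c < 50 \<Longrightarrow> P < 50 \<Longrightarrow> s c = Inl n \<Longrightarrow> s P = Inr Q \<Longrightarrow> s 3 = Inl m \<Longrightarrow>
    nsat s (subbaseF c P) \<longleftrightarrow> in_subbase n Q"
  by (simp add: subbaseF_def in_subbase_def)

lemma sat_inclF [simp]:
  "S < 30 \<Longrightarrow> T < 30 \<Longrightarrow> s S = Inr A \<Longrightarrow> s T = Inr B \<Longrightarrow> s 3 = Inl m \<Longrightarrow>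
    nsat s (inclF S T) \<longleftrightarrow> open_of A \<subseteq> open_of B"
  unfolding in_code_incl_iff[symmetric]
  by (simp add: inclF_def codeF_def in_code_def Bex_def)

end

text \<open>A numeral without constants: the conditions \<open>d + d \<noteq> d\<close> and
  \<open>d * d = d\<close> single out \<open>1\<close>. It fixes the parameter \<open>m\<close>,
  through which the dimension enters the formulas.\<close>

primrec numberF :: "nat \<Rightarrow> nat \<Rightarrow> form" where
  "numberF 0 x = plusF x x x"
| "numberF (Suc n) x = ExN (Suc x) (ExN (Suc (Suc x)) (Conj (numberF n (Suc x)) (Conj
     (Neg (plusF (Suc (Suc x)) (Suc (Suc x)) (Suc (Suc x)))) (Conj
     (timesF (Suc (Suc x)) (Suc (Suc x)) (Suc (Suc x))) (plusF (Suc x) (Suc (Suc x)) x)))))"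

lemma sat_plusF_Inl:
  "s x = Inl a \<Longrightarrow> s y = Inl b \<Longrightarrow> nsat s (plusF x y z) \<longleftrightarrow> s z = Inl (a + b)"
  by (auto simp: plusF_def N2_rel_iff)

lemma sat_numberF: "nsat s (numberF n x) \<longleftrightarrow> s x = Inl n"
proof (induction n arbitrary: s x)
  case 0
  show ?case
    by (cases "s x") (auto simp: plusF_def N2_rel_iff)
next
  case (Suc n)
  have "nsat s (numberF (Suc n) x) \<longleftrightarrow> (\<exists>k d. k = n \<and> 0 < d \<and> d = d * d \<and> s x = Inl (k + d))"
    by (simp add: Suc.IH sat_plusF_Inl)
  moreover have "0 < d \<and> d = d * d \<longleftrightarrow> d = 1" for d :: nat
    by auto
  ultimately show ?case
    by (metis Suc_eq_plus1)
qed

lemma numberF_simps: "fv (numberF n x) = {x}" "wf_form sig_N2 (numberF n x)"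
  by (induction n arbitrary: x) auto

lemma sig_N2_1 [simp]: "sig_N2 (Suc 0) = Some 1"
  by (simp add: sig_N2_def)

theorem FO_lattice_reducible:
  "m_reducible (FO sig_sub (open_lattice_dom :: (real ^ 'n) set set) subset_rel)
    (FO sig_N2 (UNIV :: (nat + nat set) set) N2_rel)"
proof -
  define m where "m = CARD('n) - 1"
  have "CARD('n) = Suc m"
    using zero_less_card_finite[where 'a = 'n] unfolding m_def by linarith
  then have "{0..<CARD('n)} = {..m}"
    by (simp only: atLeast0LessThan lessThan_Suc_atMost)
  then obtain idx :: "nat \<Rightarrow> 'n" where "bij_betw idx {..m} UNIV"
    using ex_bij_betw_nat_finite[of "UNIV :: 'n set"] by auto
  then interpret coding m idx
    by unfold_locales
  have sets: "{..<2} = {0, 1::nat}"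
    by auto
  \<comment> \<open>Every set of numbers codes an open set, so the domain is the whole sort of sets;
    different codes may give the same open set, hence mutual inclusion as equality.\<close>
  interpret interpretation_scheme "[2]" sig_N2 "\<lambda>_. inclF 0 1" "Rel 1 [0]"
    "Conj (inclF 0 1) (inclF 1 0)" "numberF m 3" "[3]" 100
  proof
    have bv: "bv (inclF 0 1) \<subseteq> {2..<100}" "bv (inclF 1 0) \<subseteq> {2..<100}"
      using inclF_simps(3)[of 0 1] inclF_simps(3)[of 1 0] by fastforce+
    show "template sig_N2 (set [3]) 100 ([2] ! r) (inclF 0 1)" if "r < length [2::nat]" for r
      using bv that by (simp add: template_def sets)
    show "template sig_N2 (set [3]) 100 1 (Rel 1 [0])"
      by (simp add: template_def lessThan_Suc)
    show "template sig_N2 (set [3]) 100 2 (Conj (inclF 0 1) (inclF 1 0))"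
      using bv by (simp add: template_def sets)
    show "[2] \<noteq> ([] :: nat list)" "[2] ! 0 \<noteq> (0 :: nat)" "sig_N2 0 \<noteq> Some 0"
      by (simp_all add: sig_N2_def)
    show "wf_form sig_N2 (numberF m 3)" "fv (numberF m 3) \<subseteq> set [3]"
      by (simp_all add: numberF_simps)
  qed
  define f where "f b = open_of (case b of Inl n \<Rightarrow> {} | Inr S \<Rightarrow> S)" for b :: "nat + nat set"
  have [simp]: "f (Inr S) = open_of S" for S
    by (simp add: f_def)
  have f: "interprets open_lattice_dom subset_rel UNIV N2_rel e f" if e: "e 3 = Inl m"
    for e :: "nat \<Rightarrow> nat + nat set"
  proof -
    have dom: "{b \<in> UNIV. nsat (update e [b]) (Rel 1 [0])} = range Inr"
      by (auto simp: update_def)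
    have incl: "nsat (update e [Inr S, Inr T]) (inclF 0 1) \<longleftrightarrow> open_of S \<subseteq> open_of T"
      "nsat (update e [Inr S, Inr T]) (inclF 1 0) \<longleftrightarrow> open_of T \<subseteq> open_of S" for S T
      using e by (simp_all add: update_def)
    have "range open_of = open_lattice_dom"
    proof (intro set_eqI iffI)
      fix U :: "(real ^ 'n) set"
      assume "U \<in> open_lattice_dom"
      then obtain S where "open_of S = U"
        using open_of_surj unfolding open_lattice_dom_def by blast
      then show "U \<in> range open_of"
        by blast
    next
      fix U :: "(real ^ 'n) set"
      assume "U \<in> range open_of"
      then show "U \<in> open_lattice_dom"
        using open_open_of unfolding open_lattice_dom_def by blast
    qed
    then have "f ` range Inr = open_lattice_dom"
      by (simp add: image_image)
    moreover have "nsat (update e [b, c]) (Conj (inclF 0 1) (inclF 1 0)) \<longleftrightarrow> f b = f c"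
      if "b \<in> range Inr" "c \<in> range Inr" for b c
      using that by (auto simp only: sat.simps incl \<open>\<And>S. f (Inr S) = open_of S\<close>)
    moreover have "nsat (update e bs) (inclF 0 1) \<longleftrightarrow> subset_rel r (map f bs)"
      if r: "r < length [2::nat]" and len: "length bs = [2] ! r" and bs: "set bs \<subseteq> range Inr" for r bs
    proof -
      have "r = 0"
        using r by simp
      moreover obtain b c where "bs = [b, c]"
        using len \<open>r = 0\<close> by (auto simp: length_Suc_conv numeral_2_eq_2)
      moreover from this bs obtain S T where "b = Inr S" "c = Inr T"
        by auto
      ultimately show ?thesis
        using incl(1)[of S T] by simp
    qed
    ultimately show ?thesis
      unfolding interprets_def dom Let_def by blast
  qed
  have "sig_sub = sigA"
    by (auto simp: sig_sub_def sigA_def)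
  moreover have "m_reducible (FO sigA (open_lattice_dom :: (real ^ 'n) set set) subset_rel)
    (FO sig_N2 (UNIV :: (nat + nat set) set) N2_rel)"
  proof (rule m_reducible)
    show "(open_lattice_dom :: (real ^ 'n) set set) \<noteq> {}"
      by (auto simp: open_lattice_dom_def)
    show "\<exists>e. range e \<subseteq> UNIV \<and> nsat e (numberF m 3)"
      unfolding sat_numberF by (intro exI[of _ "\<lambda>_. Inl m"]) simp
    show "\<exists>f :: nat + nat set \<Rightarrow> (real ^ 'n) set. interprets open_lattice_dom subset_rel UNIV N2_rel e f"
      if "nsat e (numberF m 3)" for e
      using f that unfolding sat_numberF by blast
  qed
  ultimately show ?thesis
    by simp
qed

theorem theorem3p2:
  assumes "CARD('n) \<ge> 2"
  shows "m_equiv (FO sig_sub (open_lattice_dom :: (real ^ 'n) set set) subset_rel)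
                 (FO sig_N2 (UNIV :: (nat + nat set) set) N2_rel)"
  unfolding m_equiv_def using FO_lattice_reducible FO_N2_reducible[OF assms] by blast

end
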